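(* Let $\mathcal H$ be a complex Hilbert space with $\dim\mathcal H=2$ and let $\Phi: B(\mathcal H\otimes\mathcal H)\to B(\mathcal H\otimes\mathcal H)$ be a qubit PR-channel. Then $\Phi$ is an entanglement-breaking channel.
   Context: **Channels and Choi matrices.** A channel is a completely positive trace preserving linear map. Fix an orthonormal basis $\{|0\rangle,|1\rangle\}$ of $\mathcal H=\mathbb C^2$. The Choi matrix of a channel $\Phi$ is $C(\Phi)=(\Phi\otimes\mathrm{id})(|\psi^+\rangle\langle\psi^+|)$, where $|\psi^+\rangle=\sum_i|i\rangle\otimes|i\rangle$ (sum over the standard product basis of the input space); it acts on (output)$\otimes$(input). **Bipartite non-signaling channels.** A bipartite channel $\Phi$ on $B(\mathcal H\otimes\mathcal H)$ has input space $\mathcal H_{A,in}\otimes\mathcal H_{B,in}$ and output space $\mathcal H_{A,out}\otimes\mathcal H_{B,out}$, all four factors being copies of $\mathcal H$ (first factors belong to Alice, second to Bob). It is non-signaling if its Choi matrix $C$ satisfies $\mathrm{Tr}_{A,out}(C)=\mathbb 1_{A,in}\otimes C_B$ and $\mathrm{Tr}_{B,out}(C)=\mathbb 1_{B,in}\otimes C_A$ for some positive operators $C_B$ on $\mathcal H_{B,out}\otimes\mathcal H_{B,in}$ and $C_A$ on $\mathcal H_{A,out}\otimes\mathcal H_{A,in}$. **Measurements on channels.** A two-outcome measurement on channels $B(\mathcal H)\to B(\mathcal H)$, with outcomes $1,-1$, is given by a pair of positive operators $\{F,F^\perp\}$ on $\mathcal H_{out}\otimes\mathcal H_{in}$ with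 $F+F^\perp=\mathbb 1\otimes\sigma$ for some density operator $\sigma$ on $\mathcal H_{in}$ (a PPOVM); the outcome probabilities on a channel with Choi matrix $C$ are $\mathrm{Tr}(CF)$ and $\mathrm{Tr}(CF^\perp)$. If Alice uses the measurement $\mathsf C$ given by $\{F_{\mathsf C}^{1},F_{\mathsf C}^{-1}\}$ on $\mathcal H_{A,out}\otimes\mathcal H_{A,in}$ and Bob uses $\mathsf D$ given by $\{F_{\mathsf D}^{1},F_{\mathsf D}^{-1}\}$ on $\mathcal H_{B,out}\otimes\mathcal H_{B,in}$, then for a bipartite channel $\Phi$, $P_\Phi(\epsilon,\eta|\mathsf C,\mathsf D)=\mathrm{Tr}\big((F_{\mathsf C}^{\epsilon}\otimes F_{\mathsf D}^{\eta})C(\Phi)\big)$, with tensor factors arranged accordingly. **PR-channel.** A qubit PR-channel is a non-signaling bipartite channel $\Phi$ on $B(\mathcal H\otimes\mathcal H)$ for which there exist two-outcome channel measurements $\mathsf A,\mathsf A'$ (Alice) and $\mathsf B,\mathsf B'$ (Bob) such that for all $\mathsf C\in\{\mathsf A,\mathsf A'\}$, $\mathsf D\in\{\mathsf B,\mathsf B'\}$, $\epsilon,\eta\in\{1,-1\}$: $P_\Phi(\epsilon,\eta|\mathsf C,\mathsf D)=\frac12$ if [$(\mathsf C,\mathsf D)\neq(\mathsf A',\mathsf B')$ and $\epsilon\eta=1$] or [$(\mathsf C,\mathsf D)=(\mathsf A',\mathsf B')$ and $\epsilon\eta=-1$], and $P_\Phi(\epsilon,\eta|\mathsf C,\mathsf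 D)=0$ otherwise (maximal violation of the CHSH inequality). **Entanglement-breaking.** $\Phi$ is entanglement-breaking if for every density operator $\omega$ on $(\mathcal H\otimes\mathcal H)\otimes(\mathcal H\otimes\mathcal H)$, the state $(\Phi\otimes\mathrm{id})(\omega)$ is separable with respect to the cut $(\mathcal H\otimes\mathcal H):(\mathcal H\otimes\mathcal H)$ between the output of $\Phi$ and the reference system. Equivalently, $C(\Phi)$ is separable with respect to the cut output : input. *)

theory Defs
  imports "HOL-Analysis.Analysis" "HOL-Library.Complex_Order"
begin

text \<open>
  Finite-dimensional Hilbert spaces are represented by their orthonormal basis, i.e.\ a finite
  index type: vectors are \<open>complex ^ 'a\<close>, operators are square matrices, and the tensor product
  of spaces is the product of index types. The space of a qubit is \<open>complex ^ 2\<close>.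
\<close>

type_synonym 'a op = "complex ^ 'a ^ 'a"

definition cinner :: "complex ^ 'a::finite \<Rightarrow> complex ^ 'a \<Rightarrow> complex"
  where "cinner v w = (\<Sum>i\<in>UNIV. cnj (v $ i) * w $ i)"

text \<open>
  The order is that of \<^theory>\<open>HOL-Library.Complex_Order\<close>: \<open>0 \<le> z\<close> says that \<open>z\<close> is real and
  nonnegative. Hermiticity follows, the scalars being complex.
\<close>

definition pos_op :: "'a::finite op \<Rightarrow> bool"
  where "pos_op A \<longleftrightarrow> (\<forall>v. 0 \<le> cinner v (A *v v))"

definition density :: "'a::finite op \<Rightarrow> bool"
  where "density \<rho> \<longleftrightarrow> pos_op \<rho> \<and> trace \<rho> = 1"

definition scale_op :: "complex \<Rightarrow> 'a::finite op \<Rightarrow> 'a op"  (infixr \<open>*\<^sub>C\<close> 75)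
  where "c *\<^sub>C A = (\<chi> i j. c * A $ i $ j)"

definition tensor_vec :: "complex ^ 'a::finite \<Rightarrow> complex ^ 'b::finite \<Rightarrow> complex ^ ('a \<times> 'b)"
  where "tensor_vec v w = (\<chi> p. v $ fst p * w $ snd p)"

definition tensor_op :: "'a::finite op \<Rightarrow> 'b::finite op \<Rightarrow> ('a \<times> 'b) op"  (infixr \<open>\<otimes>\<close> 70)
  where "A \<otimes> B = (\<chi> p q. A $ fst p $ fst q * B $ snd p $ snd q)"

definition ketbra :: "complex ^ 'a::finite \<Rightarrow> 'a op"
  where "ketbra v = (\<chi> i j. v $ i * cnj (v $ j))"

text \<open>
  \<open>\<Phi> \<otimes> id\<close>: apply \<open>\<Phi>\<close> to each block of \<open>\<omega>\<close> with fixed indices of the second factor.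
  The lemma \<open>tensor_id_tensor_op\<close> below characterises it on product operators.
\<close>

definition tensor_id ::
    "('n::finite op \<Rightarrow> 'm::finite op) \<Rightarrow> ('n \<times> 'r::finite) op \<Rightarrow> ('m \<times> 'r) op"
  where "tensor_id \<Phi> \<omega> =
    (\<chi> p q. \<Phi> (\<chi> i j. \<omega> $ (i, snd p) $ (j, snd q)) $ fst p $ fst q)"

text \<open>
  Positivity of the \<open>n \<times> n\<close> block operator \<open>(M i j)\<close>, i.e.\ of
  \<open>\<Sum>i j. M i j \<otimes> |i\<rangle>\<langle>j|\<close> with an \<open>n\<close>-dimensional second factor. Blocks are indexed by \<open>nat\<close>
  because complete positivity quantifies over the dimension \<open>n\<close> of the reference space.
\<close>

definition pos_block :: "nat \<Rightarrow> (nat \<Rightarrow> nat \<Rightarrow> 'a::finite op) \<Rightarrow> bool"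
  where "pos_block n M \<longleftrightarrow>
    (\<forall>v :: nat \<Rightarrow> complex ^ 'a. 0 \<le> (\<Sum>i<n. \<Sum>j<n. cinner (v i) (M i j *v v j)))"

definition completely_positive :: "('n::finite op \<Rightarrow> 'm::finite op) \<Rightarrow> bool"
  where "completely_positive \<Phi> \<longleftrightarrow>
    (\<forall>n M. pos_block n M \<longrightarrow> pos_block n (\<lambda>i j. \<Phi> (M i j)))"

definition channel :: "('n::finite op \<Rightarrow> 'm::finite op) \<Rightarrow> bool"
  where "channel \<Phi> \<longleftrightarrow>
    Vector_Spaces.linear (*\<^sub>C) (*\<^sub>C) \<Phi> \<and>
    completely_positive \<Phi> \<and>
    (\<forall>A. trace (\<Phi> A) = trace A)"

definition psi_plus :: "complex ^ ('n::finite \<times> 'n)"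
  where "psi_plus = (\<Sum>i\<in>UNIV. tensor_vec (axis i 1) (axis i 1))"

definition choi :: "('n::finite op \<Rightarrow> 'm::finite op) \<Rightarrow> ('m \<times> 'n) op"
  where "choi \<Phi> = tensor_id \<Phi> (ketbra psi_plus)"

definition separable :: "('a::finite \<times> 'b::finite) op \<Rightarrow> bool"
  where "separable \<rho> \<longleftrightarrow>
    (\<exists>(n::nat) (p :: nat \<Rightarrow> real) \<sigma> \<tau>.
      (\<forall>k<n. 0 \<le> p k \<and> density (\<sigma> k) \<and> density (\<tau> k)) \<and>
      (\<Sum>k<n. p k) = 1 \<and>
      \<rho> = (\<Sum>k<n. of_real (p k) *\<^sub>C (\<sigma> k \<otimes> \<tau> k)))"

text \<open>The reference system is a copy of the input system.\<close>

definition entanglement_breaking :: "('n::finite op \<Rightarrow> 'm::finite op) \<Rightarrow> bool"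
  where "entanglement_breaking \<Phi> \<longleftrightarrow>
    (\<forall>\<omega> :: ('n \<times> 'n) op. density \<omega> \<longrightarrow> separable (tensor_id \<Phi> \<omega>))"

text \<open>
  A bipartite channel maps operators on (A,in) \<open>\<otimes>\<close> (B,in), indexed by \<open>'i \<times> 'j\<close>, to operators on
  (A,out) \<open>\<otimes>\<close> (B,out), indexed by \<open>'a \<times> 'b\<close>. Its Choi matrix is indexed by
  \<open>('a \<times> 'b) \<times> ('i \<times> 'j)\<close>; \<open>bichoi\<close> reorders the tensor factors to Alice : Bob, that is to
  ((A,out) \<open>\<otimes>\<close> (A,in)) \<open>\<otimes>\<close> ((B,out) \<open>\<otimes>\<close> (B,in)).
\<close>

definition bichoi ::
    "(('i::finite \<times> 'j::finite) op \<Rightarrow> ('a::finite \<times> 'b::finite) op) \<Rightarrow>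
     (('a \<times> 'i) \<times> ('b \<times> 'j)) op"
  where "bichoi \<Phi> =
    (let r = (\<lambda>((a, i), (b, j)). ((a, b), (i, j)))
     in \<chi> p q. choi \<Phi> $ r p $ r q)"

definition trace_Aout ::
    "(('a::finite \<times> 'i::finite) \<times> 'b::finite) op \<Rightarrow> ('i \<times> 'b) op"
  where "trace_Aout C =
    (\<chi> p q. \<Sum>a\<in>UNIV. C $ ((a, fst p), snd p) $ ((a, fst q), snd q))"

definition trace_Bout ::
    "('a::finite \<times> ('b::finite \<times> 'j::finite)) op \<Rightarrow> ('a \<times> 'j) op"
  where "trace_Bout C =
    (\<chi> p q. \<Sum>b\<in>UNIV. C $ (fst p, (b, snd p)) $ (fst q, (b, snd q)))"

definition non_signaling ::
    "(('i::finite \<times> 'j::finite) op \<Rightarrow> ('a::finite \<times> 'b::finite) op) \<Rightarrow> bool"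
  where "non_signaling \<Phi> \<longleftrightarrow>
    (\<exists>C_B. pos_op C_B \<and> trace_Aout (bichoi \<Phi>) = mat 1 \<otimes> C_B) \<and>
    (\<exists>C_A. pos_op C_A \<and> trace_Bout (bichoi \<Phi>) = C_A \<otimes> mat 1)"

text \<open>
  A two-outcome measurement on channels is given by a function from outcomes to operators on
  (out) \<open>\<otimes>\<close> (in); only its values at the outcomes \<open>1\<close> and \<open>-1\<close> matter.
\<close>

definition ppovm :: "(int \<Rightarrow> ('a::finite \<times> 'i::finite) op) \<Rightarrow> bool"
  where "ppovm F \<longleftrightarrow>
    pos_op (F 1) \<and> pos_op (F (-1)) \<and>
    (\<exists>\<sigma>. density \<sigma> \<and> F 1 + F (-1) = mat 1 \<otimes> \<sigma>)"

definition joint_prob ::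
    "(('i::finite \<times> 'j::finite) op \<Rightarrow> ('a::finite \<times> 'b::finite) op) \<Rightarrow>
     (int \<Rightarrow> ('a \<times> 'i) op) \<Rightarrow> (int \<Rightarrow> ('b \<times> 'j) op) \<Rightarrow> int \<Rightarrow> int \<Rightarrow> complex"
  where "joint_prob \<Phi> F G \<epsilon> \<eta> = trace ((F \<epsilon> \<otimes> G \<eta>) ** bichoi \<Phi>)"

text \<open>
  The settings \<open>False\<close> and \<open>True\<close> stand for the unprimed and the primed measurement, so that
  \<open>x \<and> y\<close> says that both parties use their primed measurement. The cases are distinguished
  by setting, so the primed and unprimed measurements are not required to differ as operators.
\<close>

definition PR_channel ::
    "(('i::finite \<times> 'j::finite) op \<Rightarrow> ('a::finite \<times> 'b::finite) op) \<Rightarrow> bool"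
  where "PR_channel \<Phi> \<longleftrightarrow>
    channel \<Phi> \<and> non_signaling \<Phi> \<and>
    (\<exists>(A :: bool \<Rightarrow> int \<Rightarrow> ('a \<times> 'i) op) (B :: bool \<Rightarrow> int \<Rightarrow> ('b \<times> 'j) op).
      (\<forall>x. ppovm (A x)) \<and> (\<forall>y. ppovm (B y)) \<and>
      (\<forall>x y. \<forall>\<epsilon>\<in>{1, -1}. \<forall>\<eta>\<in>{1, -1}.
        joint_prob \<Phi> (A x) (B y) \<epsilon> \<eta> =
          (if (\<not> (x \<and> y) \<and> \<epsilon> * \<eta> = 1) \<or> ((x \<and> y) \<and> \<epsilon> * \<eta> = -1) then 1 / 2 else 0)))"

lemma vector_space_scale_op: "vector_space ((*\<^sub>C) :: complex \<Rightarrow> 'a::finite op \<Rightarrow> 'a op)"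
  by unfold_locales (simp_all add: scale_op_def vec_eq_iff algebra_simps)

lemma tensor_id_tensor_op:
  fixes X :: "'r::finite op"
  assumes "Vector_Spaces.linear (*\<^sub>C) (*\<^sub>C) \<Phi>"
  shows "tensor_id \<Phi> (A \<otimes> X) = \<Phi> A \<otimes> X"
proof -
  have "\<Phi> (c *\<^sub>C A) = c *\<^sub>C \<Phi> A" for c
    using assms by (simp add: Vector_Spaces.linear_def module_hom.scale)
  then have "\<Phi> (\<chi> i j. A $ i $ j * c) = (\<chi> i j. \<Phi> A $ i $ j * c)" for c
    by (simp add: scale_op_def mult.commute)
  then show ?thesis
    by (simp add: tensor_id_def tensor_op_def)
qed

lemma psi_plus_nth: "(psi_plus :: complex ^ ('n::finite \<times> 'n)) $ (i, j) = (if i = j then 1 else 0)"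
proof -
  have "(psi_plus :: complex ^ ('n \<times> 'n)) $ (i, j) =
      (\<Sum>k\<in>UNIV. (if k = i then (if i = j then 1 else 0) else 0))"
    unfolding psi_plus_def sum_component
    by (intro sum.cong refl) (auto simp: tensor_vec_def axis_def)
  then show ?thesis by simp
qed

lemma pos_op_tensor_id:
  fixes \<Phi> :: "'n::finite op \<Rightarrow> 'm::finite op" and \<omega> :: "('n \<times> 'r::finite) op"
  assumes cp: "completely_positive \<Phi>" and pos: "pos_op \<omega>"
  shows "pos_op (tensor_id \<Phi> \<omega>)"
proof -
  obtain e :: "nat \<Rightarrow> 'r" where e: "bij_betw e {..<CARD('r)} UNIV"
    using ex_bij_betw_nat_finite[of "UNIV :: 'r set"] by (auto simp: atLeast0LessThan)
  define M where "M = (\<lambda>k l. (\<chi> i j. \<omega> $ (i, e k) $ (j, e l)))"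
  have UNIV_pair: "(\<Sum>p\<in>UNIV. g p) = (\<Sum>i\<in>UNIV. \<Sum>r\<in>UNIV. g (i, r))"
    for g :: "'a::finite \<times> 'r \<Rightarrow> complex"
    by (simp add: sum.cartesian_product flip: UNIV_Times_UNIV)
  have split: "cinner w (W *v w) =
      (\<Sum>k<CARD('r). \<Sum>l<CARD('r). cinner (\<chi> i. w $ (i, e k))
        ((\<chi> i j. W $ (i, e k) $ (j, e l)) *v (\<chi> i. w $ (i, e l))))"
    for w :: "complex ^ ('a::finite \<times> 'r)" and W :: "('a \<times> 'r) op"
  proof -
    have "cinner w (W *v w) =
        (\<Sum>i\<in>UNIV. \<Sum>r\<in>UNIV. \<Sum>j\<in>UNIV. \<Sum>s\<in>UNIV.
          cnj (w $ (i, r)) * (W $ (i, r) $ (j, s) * w $ (j, s)))"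
      by (simp add: cinner_def matrix_vector_mult_def sum_distrib_left UNIV_pair)
    also have "\<dots> = (\<Sum>r\<in>UNIV. \<Sum>s\<in>UNIV. \<Sum>i\<in>UNIV. \<Sum>j\<in>UNIV.
          cnj (w $ (i, r)) * (W $ (i, r) $ (j, s) * w $ (j, s)))"
      by (subst sum.swap, intro sum.cong refl,
          subst (2) sum.swap, subst sum.swap, rule refl)
    also have "\<dots> = (\<Sum>k<CARD('r). \<Sum>l<CARD('r). \<Sum>i\<in>UNIV. \<Sum>j\<in>UNIV.
          cnj (w $ (i, e k)) * (W $ (i, e k) $ (j, e l) * w $ (j, e l)))"
      by (simp add: sum.reindex_bij_betw[OF e, symmetric])
    finally show ?thesis
      by (simp add: cinner_def matrix_vector_mult_def sum_distrib_left)
  qed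
  have "pos_block CARD('r) M"
    unfolding pos_block_def
  proof
    fix v :: "nat \<Rightarrow> complex ^ 'n"
    define w where "w = (\<chi> p. v (the_inv_into {..<CARD('r)} e (snd p)) $ fst p)"
    have "(\<chi> i. w $ (i, e k)) = v k" if "k < CARD('r)" for k
      using that e by (simp add: w_def vec_eq_iff bij_betw_def the_inv_into_f_f)
    then have eq: "cinner w (\<omega> *v w) =
        (\<Sum>k<CARD('r). \<Sum>l<CARD('r). cinner (v k) (M k l *v v l))"
      by (simp add: split M_def)
    then show "0 \<le> (\<Sum>k<CARD('r). \<Sum>l<CARD('r). cinner (v k) (M k l *v v l))"
      using pos by (simp add: pos_op_def flip: eq)
  qed
  then have blk: "pos_block CARD('r) (\<lambda>k l. \<Phi> (M k l))"
    using cp by (simp add: completely_positive_def)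
  show ?thesis
    unfolding pos_op_def
  proof
    fix w :: "complex ^ ('m \<times> 'r)"
    have "(\<chi> i j. tensor_id \<Phi> \<omega> $ (i, e k) $ (j, e l)) = \<Phi> (M k l)" for k l
      by (simp add: tensor_id_def M_def vec_eq_iff)
    then show "0 \<le> cinner w (tensor_id \<Phi> \<omega> *v w)"
      using blk by (simp add: split[of w] pos_block_def)
  qed
qed

end

theory Submission
  imports Defs
begin

text \<open>
  Conditioning the Choi matrix on Bob's outcomes gives Alice operators that her two measurements
  discriminate perfectly in the pattern of a square. As both of Bob's settings give the same average,
  \<open>\<sigma> False ** \<sigma> True = 0\<close> for the input states of Alice's measurements. For a qubit these are thus
  orthogonal pure states, and the measurements are projective on the output; the same holds for Bob.
  In the resulting product vectors the Choi matrix is supported on eight vectors, and by the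
  non-signaling conditions an off-diagonal entry can only link two of them whose output vectors are
  orthogonal both at Alice's and at Bob's side. So it splits into blocks of the form
  \<open>1/2 [[1, Y], [Y*, 1]]\<close> with a contraction \<open>Y\<close>, on (two orthogonal output vectors) \<open>\<otimes>\<close> (some inputs).
  Such a block is separable across output : input: the Fejer kernel \<open>E(z)\<close> of \<open>Y\<close> is positive,
  and averaging \<open>|t + z t'><t + z t'| \<otimes> E(z)\<close> over roots of unity gives the block with \<open>Y\<close> replaced by
  \<open>(1 - 1/n) Y\<close>, so that separability follows as \<open>n\<close> tends to infinity.
\<close>

section \<open>Positive operators and tensor products\<close>

text \<open>An off-diagonal entry between two settings compares two output bases with no prescribed
  relation. So the output trace in the non-signaling condition is expanded in both bases at once,
  weighted by their overlaps. For different inputs of a party the orthogonality of its input states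
  makes this sum vanish, while the PR pattern leaves a single term; hence the overlap of the output
  vectors is zero. For equal inputs of a party the sum cannot depend on that input, and after
  switching the input no term with equal outcomes is allowed. In dimension two orthogonality
  determines a vector only up to phase, whereas a block needs literally the same two output vectors
  throughout; so every ray receives a fixed representative. If \<open>Y\<close> were unitary, an
  eigenbasis would give the product vectors directly. For a mere contraction the Fejer kernel takes
  the place of the spectral decomposition. It reaches only \<open>(1 - 1/n) Y\<close>, which is why
  the cone of separable operators must be shown to be closed.\<close>

lemma sum_UNIV_prod:
  "(\<Sum>p\<in>UNIV. g p) = (\<Sum>i\<in>UNIV. \<Sum>r\<in>UNIV. g (i, r))"
  for g :: "'a::finite \<times> 'b::finite \<Rightarrow> 'c::comm_monoid_add"
  by (simp add: sum.cartesian_product flip: UNIV_Times_UNIV)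

definition outer :: "complex ^ 'a::finite \<Rightarrow> complex ^ 'a \<Rightarrow> 'a op"
  where "outer v w = (\<chi> i j. v $ i * cnj (w $ j))"

lemma ketbra_eq_outer: "ketbra v = outer v v"
  by (simp add: ketbra_def outer_def)

lemma cinner_add_right: "cinner v (w + w') = cinner v w + cinner v w'"
  by (simp add: cinner_def sum.distrib algebra_simps)

lemma cinner_add_left: "cinner (v + v') w = cinner v w + cinner v' w"
  by (simp add: cinner_def sum.distrib algebra_simps)

lemma cinner_diff_right: "cinner v (w - w') = cinner v w - cinner v w'"
  by (simp add: cinner_def sum_subtractf algebra_simps)

lemma cinner_diff_left: "cinner (v - v') w = cinner v w - cinner v' w"
  by (simp add: cinner_def sum_subtractf algebra_simps)

lemma cinner_scale_right: "cinner v (c *s w) = c * cinner v w"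
  by (simp add: cinner_def sum_distrib_left algebra_simps)

lemma cinner_scale_left: "cinner (c *s v) w = cnj c * cinner v w"
  by (simp add: cinner_def sum_distrib_left algebra_simps)

lemma cinner_zero_right [simp]: "cinner v 0 = 0"
  by (simp add: cinner_def)

lemma cinner_zero_left [simp]: "cinner 0 v = 0"
  by (simp add: cinner_def)

lemma cinner_sum_right: "cinner v (\<Sum>k\<in>S. w k) = (\<Sum>k\<in>S. cinner v (w k))"
  by (induction S rule: infinite_finite_induct) (auto simp: cinner_add_right)

lemma cinner_commute: "cinner w v = cnj (cinner v w)"
  by (simp add: cinner_def mult.commute)

lemma cinner_self: "cinner v v = of_real ((norm v)\<^sup>2)"
proof -
  have "cinner v v = of_real (\<Sum>i\<in>UNIV. (norm (v $ i))\<^sup>2)"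
    unfolding cinner_def of_real_sum
    by (intro sum.cong refl) (metis complex_norm_square mult.commute)
  also have "(\<Sum>i\<in>UNIV. (norm (v $ i))\<^sup>2) = (norm v)\<^sup>2"
    by (simp add: norm_vec_def L2_set_def sum_nonneg)
  finally show ?thesis .
qed

lemma cinner_nonneg: "0 \<le> cinner v v"
  by (simp add: cinner_self less_eq_complex_def)

lemma cinner_axis: "cinner (axis i 1) v = v $ i"
proof -
  have "cinner (axis i 1) v = (\<Sum>j\<in>UNIV. if j = i then v $ j else 0)"
    unfolding cinner_def by (intro sum.cong refl) (auto simp: axis_def)
  then show ?thesis by simp
qed

lemma mult_axis: "A *v axis j 1 = (\<chi> i. A $ i $ j)" for A :: "'a::finite op"
proof -
  have "(\<Sum>k\<in>UNIV. A $ i $ k * axis j 1 $ k) = (\<Sum>k\<in>UNIV. if k = j then A $ i $ k else 0)" for i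
    by (intro sum.cong refl) (auto simp: axis_def)
  then show ?thesis
    unfolding matrix_vector_mult_def by simp
qed

lemma cinner_axis_mult: "cinner (axis i 1) (A *v axis j 1) = A $ i $ j" for A :: "'a::finite op"
  by (simp add: cinner_axis mult_axis)

lemma op_eqI: "(\<And>i. A *v axis i 1 = B *v axis i 1) \<Longrightarrow> A = B" for A :: "'a::finite op"
  by (simp add: mult_axis vec_eq_iff)

lemma mult_outer: "A ** outer v w = outer (A *v v) w"
  by (simp add: outer_def matrix_matrix_mult_def matrix_vector_mult_def vec_eq_iff
      sum_distrib_right mult.assoc)

lemma outer_mult_vec: "outer v w *v x = cinner w x *s v"
  by (simp add: outer_def cinner_def matrix_vector_mult_def vec_eq_iff
      sum_distrib_left sum_distrib_right algebra_simps)

lemma trace_outer: "trace (outer v w) = cinner w v"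
  by (simp add: outer_def cinner_def trace_def mult.commute)

lemma scale_op_mult_vec: "(c *\<^sub>C A) *v v = c *s (A *v v)"
  by (simp add: scale_op_def matrix_vector_mult_def vec_eq_iff sum_distrib_left algebra_simps)

lemma scale_op_mult_left: "(c *\<^sub>C A) ** B = c *\<^sub>C (A ** B)"
  by (simp add: scale_op_def matrix_matrix_mult_def vec_eq_iff sum_distrib_left algebra_simps)

lemma scale_op_mult_right: "A ** (c *\<^sub>C B) = c *\<^sub>C (A ** B)"
  by (simp add: scale_op_def matrix_matrix_mult_def vec_eq_iff sum_distrib_left algebra_simps)

lemma scale_op_scale_op: "c *\<^sub>C d *\<^sub>C A = (c * d) *\<^sub>C A"
  by (simp add: scale_op_def vec_eq_iff)

lemma scale_op_one [simp]: "1 *\<^sub>C A = A"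
  by (simp add: scale_op_def vec_eq_iff)

lemma scale_op_eq_0_iff: "c *\<^sub>C A = 0 \<longleftrightarrow> c = 0 \<or> A = 0"
  by (auto simp: scale_op_def vec_eq_iff)

lemma trace_scale_op: "trace (c *\<^sub>C A) = c * trace A"
  by (simp add: scale_op_def trace_def sum_distrib_left)

lemma matrix_sum_rdistrib: "(\<Sum>k\<in>S. f k) *v v = (\<Sum>k\<in>S. f k *v v)"
  for f :: "'k \<Rightarrow> 'a::finite op"
  by (induction S rule: infinite_finite_induct)
    (auto simp: matrix_vector_mult_add_rdistrib)

lemma mult_vec_sum: "A *v (\<Sum>k\<in>S. f k) = (\<Sum>k\<in>S. A *v f k)" for A :: "'a::finite op"
  by (induction S rule: infinite_finite_induct)
    (auto simp: matrix_vector_right_distrib)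

lemma mult_sum_left: "A ** (\<Sum>k\<in>S. f k) = (\<Sum>k\<in>S. A ** f k)"
  for f :: "'k \<Rightarrow> 'a::finite op"
  by (induction S rule: infinite_finite_induct)
    (auto simp: matrix_add_ldistrib)

lemma trace_sum: "trace (\<Sum>k\<in>S. f k) = (\<Sum>k\<in>S. trace (f k))"
  for f :: "'k \<Rightarrow> 'a::finite op"
  by (induction S rule: infinite_finite_induct) (auto simp: trace_add, simp_all add: trace_def)

lemma pos_opD: "pos_op A \<Longrightarrow> 0 \<le> cinner v (A *v v)"
  by (simp add: pos_op_def)

text \<open>Polarisation: the form is real at \<open>v\<close>, \<open>w\<close>,
  \<open>v + w\<close> and \<open>v + \<i> *s w\<close>, and this fixes both the imaginary and the
  real part.\<close>

lemma pos_op_hermitian: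
  assumes "pos_op A"
  shows "cinner v (A *v w) = cnj (cinner w (A *v v))"
proof -
  define q where "q = (\<lambda>v. cinner v (A *v v))"
  have im: "Im (q x) = 0" for x
    using pos_opD[OF assms, of x] by (simp add: q_def less_eq_complex_def)
  have "q (v + w) = q v + q w + cinner v (A *v w) + cinner w (A *v v)"
    by (simp add: q_def cinner_add_left cinner_add_right matrix_vector_right_distrib)
  moreover have "q (v + \<i> *s w) = q v + q w + \<i> * cinner v (A *v w) - \<i> * cinner w (A *v v)"
    by (simp add: q_def cinner_add_left cinner_add_right matrix_vector_right_distrib
        cinner_scale_left cinner_scale_right vector_scalar_commute algebra_simps)
  ultimately have "Im (cinner v (A *v w)) + Im (cinner w (A *v v)) = 0"
    "Re (cinner v (A *v w)) = Re (cinner w (A *v v))"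
    using im[of v] im[of w] im[of "v + w"] im[of "v + \<i> *s w"] by auto
  then show ?thesis
    by (simp add: complex_eq_iff)
qed

lemma pos_op_cnj: "pos_op A \<Longrightarrow> A $ i $ j = cnj (A $ j $ i)"
  using pos_op_hermitian[of A "axis i 1" "axis j 1"] by (simp add: cinner_axis_mult)

text \<open>Along \<open>v - t A v\<close> with real \<open>t\<close> the form is a quadratic
  polynomial without constant term. Being nonnegative everywhere, it has no linear term either, and
  that term is a multiple of \<open>(norm (A *v v))\<^sup>2\<close>.\<close>

lemma pos_op_kernel:
  assumes "pos_op A" "cinner v (A *v v) = 0"
  shows "A *v v = 0"
proof -
  define w where "w = A *v v"
  define b where "b = Re (cinner w (A *v w))"
  define s where "s = (norm w)\<^sup>2"
  have b: "cinner w (A *v w) = of_real b" "0 \<le> b"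
    using pos_opD[OF assms(1), of w] by (auto simp: b_def complex_eq_iff less_eq_complex_def)
  have wv: "cinner w (A *v v) = of_real s" and vw: "cinner v (A *v w) = of_real s"
    using pos_op_hermitian[OF assms(1), of v w] by (auto simp: w_def[symmetric] s_def cinner_self)
  have *: "0 \<le> t\<^sup>2 * b - 2 * t * s" for t :: real
  proof -
    have "cinner (v - of_real t *s w) (A *v (v - of_real t *s w)) = of_real (t\<^sup>2 * b - 2 * t * s)"
      by (simp add: cinner_diff_left cinner_diff_right matrix_vector_mult_diff_distrib
          cinner_scale_left cinner_scale_right vector_scalar_commute assms(2) wv vw b
          algebra_simps power2_eq_square)
    then show ?thesis
      using pos_opD[OF assms(1), of "v - of_real t *s w"] by (simp add: less_eq_complex_def)
  qed
  have "s = 0"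
  proof (cases "b = 0")
    case True
    then show ?thesis using *[of 1] by (simp add: s_def)
  next
    case False
    then have "0 \<le> - (s\<^sup>2 / b)"
      using *[of "s / b"] by (simp add: power2_eq_square field_simps)
    then have "s\<^sup>2 / b \<le> 0" by simp
    then show ?thesis using False b(2) by (simp add: divide_le_0_iff)
  qed
  then show ?thesis by (simp add: s_def w_def)
qed

lemma pos_op_add: "pos_op A \<Longrightarrow> pos_op B \<Longrightarrow> pos_op (A + B)"
  by (simp add: pos_op_def matrix_vector_mult_add_rdistrib cinner_add_right)

lemma pos_op_zero [simp]: "pos_op 0"
  by (simp add: pos_op_def)

lemma pos_op_sum: "(\<And>k. k \<in> S \<Longrightarrow> pos_op (f k)) \<Longrightarrow> pos_op (\<Sum>k\<in>S. f k)"
  by (induction S rule: infinite_finite_induct) (auto simp: pos_op_add)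

lemma pos_op_scale: "0 \<le> c \<Longrightarrow> pos_op A \<Longrightarrow> pos_op (c *\<^sub>C A)"
  by (simp add: pos_op_def scale_op_mult_vec cinner_scale_right)

lemma pos_op_reindex:
  fixes A :: "'a::finite op" and r :: "'b::finite \<Rightarrow> 'a"
  assumes "pos_op A" "bij r"
  shows "pos_op (\<chi> p q. A $ r p $ r q)"
  unfolding pos_op_def
proof
  fix v :: "complex ^ 'b"
  define w where "w = (\<chi> s. v $ inv r s)"
  have v: "v $ p = w $ r p" for p
    using assms(2) by (simp add: w_def bij_is_inj)
  have "cinner v ((\<chi> p q. A $ r p $ r q) *v v) = cinner w (A *v w)"
    unfolding cinner_def matrix_vector_mult_def v
    by (simp add: sum.reindex_bij_betw[OF assms(2), of "\<lambda>s. A $ _ $ s * w $ s"]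
        sum.reindex_bij_betw[OF assms(2), of "\<lambda>s. cnj (w $ s) * (\<Sum>j\<in>UNIV. A $ s $ j * w $ j)"])
  then show "0 \<le> cinner v ((\<chi> p q. A $ r p $ r q) *v v)"
    using pos_opD[OF assms(1)] by simp
qed

lemma pos_op_ketbra: "pos_op (ketbra v)"
proof -
  have "cinner w (ketbra v *v w) = cinner v w * cnj (cinner v w)" for w
    by (simp add: ketbra_eq_outer outer_mult_vec cinner_scale_right cinner_commute[of v w])
  then show ?thesis
    unfolding pos_op_def by (simp add: complex_mult_cnj less_eq_complex_def)
qed

text \<open>One step of the Cholesky decomposition removes a nonzero diagonal entry.\<close>

lemma pos_op_sum_ketbra:
  assumes "pos_op A"
  shows "\<exists>(n::nat) v. A = (\<Sum>k<n. ketbra (v k))"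
  using assms
proof (induction "card {i. A $ i $ i \<noteq> 0}" arbitrary: A rule: less_induct)
  case less
  have col: "A *v axis j 1 = 0" if "A $ j $ j = 0" for j
    using pos_op_kernel[OF less.prems, of "axis j 1"] that by (simp add: cinner_axis_mult)
  show ?case
  proof (cases "\<exists>i. A $ i $ i \<noteq> 0")
    case False
    then have "A = 0"
      using col by (intro op_eqI) (auto simp: matrix_vector_mult_0)
    then show ?thesis by (intro exI[of _ 0]) simp
  next
    case True
    then obtain i where i: "A $ i $ i \<noteq> 0" by blast
    define a where "a = Re (A $ i $ i)"
    have "0 \<le> A $ i $ i"
      using pos_opD[OF less.prems, of "axis i 1"] by (simp add: cinner_axis_mult)
    then have a: "A $ i $ i = of_real a" "0 < a"
      using i by (auto simp: a_def complex_eq_iff less_eq_complex_def)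
    define e :: "complex ^ 'a" where "e = axis i 1"
    define v where "v = of_real (1 / sqrt a) *s (A *v e)"
    \<comment> \<open>This is the Schur complement of the entry at \<open>i\<close>, bordered by a
      zero row and a zero column.\<close>
    define B where "B = A - ketbra v"
    have vi: "v $ j = A $ j $ i / of_real (sqrt a)" for j
      by (simp add: v_def e_def mult_axis)
    have sq: "complex_of_real (sqrt a) * complex_of_real (sqrt a) = of_real a"
      using a by (simp flip: of_real_mult)
    have Bij: "B $ j $ k = A $ j $ k - A $ j $ i * A $ i $ k / of_real a" for j k
      using pos_op_cnj[OF less.prems, of i k]
      by (simp add: B_def ketbra_def vi sq)
    have posB: "pos_op B"
      unfolding pos_op_def
    proof
      fix w
      \<comment> \<open>The minimiser of the form of \<open>A\<close> on the line
        \<open>w - t e\<close>: completing the square turns the form of \<open>B\<close> at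
        \<open>w\<close> into that of \<open>A\<close> at this point.\<close>
      define t where "t = cinner e (A *v w) / of_real a"
      have eAe: "cinner e (A *v e) = of_real a"
        using a by (simp add: e_def cinner_axis_mult)
      have wAe: "cinner w (A *v e) = cnj (cinner e (A *v w))"
        by (rule pos_op_hermitian[OF less.prems])
      have "cinner w (B *v w) = cinner w (A *v w) - cinner v w * cinner w v"
        by (simp add: B_def matrix_vector_mult_diff_rdistrib cinner_diff_right
            ketbra_eq_outer outer_mult_vec cinner_scale_right)
      also have "cinner w v = cnj (cinner e (A *v w)) / of_real (sqrt a)"
        by (simp add: v_def cinner_scale_right wAe)
      also have "cinner v w = cinner e (A *v w) / of_real (sqrt a)"
        by (subst cinner_commute) (simp add: v_def cinner_scale_right wAe)
      finally have "cinner w (B *v w) =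
          cinner w (A *v w) - cinner e (A *v w) * cnj (cinner e (A *v w)) / of_real a"
        by (simp add: sq)
      also have "\<dots> = cinner (w - t *s e) (A *v (w - t *s e))"
        using a(2)
        by (simp add: cinner_diff_left cinner_diff_right matrix_vector_mult_diff_distrib
            cinner_scale_left cinner_scale_right vector_scalar_commute eAe wAe t_def field_simps)
      finally show "0 \<le> cinner w (B *v w)"
        using pos_opD[OF less.prems] by simp
    qed
    have "{j. B $ j $ j \<noteq> 0} \<subset> {j. A $ j $ j \<noteq> 0}"
    proof
      show "{j. B $ j $ j \<noteq> 0} \<subseteq> {j. A $ j $ j \<noteq> 0}"
      proof (clarsimp)
        fix j assume "A $ j $ j = 0" "B $ j $ j \<noteq> 0"
        moreover have "A $ i $ j = 0"
          using col[OF \<open>A $ j $ j = 0\<close>] by (simp add: mult_axis vec_eq_iff)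
        ultimately show False by (simp add: Bij)
      qed
      have "B $ i $ i = 0" using a by (simp add: Bij)
      then show "{j. B $ j $ j \<noteq> 0} \<noteq> {j. A $ j $ j \<noteq> 0}" using i by blast
    qed
    then have "card {j. B $ j $ j \<noteq> 0} < card {j. A $ j $ j \<noteq> 0}"
      by (intro psubset_card_mono) auto
    then obtain n :: nat and u where "B = (\<Sum>k<n. ketbra (u k))"
      using less.hyps posB by blast
    then have "A = (\<Sum>k<Suc n. ketbra ((u(n := v)) k))"
      by (simp add: B_def algebra_simps)
    then show ?thesis by blast
  qed
qed

text \<open>In a rank-one decomposition of \<open>B\<close> the trace is a sum of nonnegative values
  of the form of \<open>A\<close>, so each vanishes and \<open>A\<close> annihilates every vector of
  the decomposition. In this way a zero probability becomes an operator equation.\<close>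

lemma pos_op_trace_mult_eq_0:
  assumes "pos_op A" "pos_op B" "trace (A ** B) = 0"
  shows "A ** B = 0"
proof -
  obtain n :: nat and v where B: "B = (\<Sum>k<n. ketbra (v k))"
    using pos_op_sum_ketbra[OF assms(2)] by blast
  have "(\<Sum>k<n. cinner (v k) (A *v v k)) = 0"
    using assms(3) by (simp add: B mult_sum_left trace_sum ketbra_eq_outer mult_outer trace_outer)
  then have "cinner (v k) (A *v v k) = 0" if "k < n" for k
    using that sum_nonneg_eq_0_iff[of "{..<n}" "\<lambda>k. cinner (v k) (A *v v k)"] pos_opD[OF assms(1)]
    by auto
  then have "A *v v k = 0" if "k < n" for k
    using that pos_op_kernel[OF assms(1)] by blast
  then show ?thesis
    by (simp add: B mult_sum_left ketbra_eq_outer mult_outer) (simp add: outer_def vec_eq_iff)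
qed

lemma pos_op_mat_1: "pos_op (mat 1)"
  by (simp add: pos_op_def cinner_nonneg)

lemma tensor_op_mult: "(A \<otimes> B) ** (A' \<otimes> B') = (A ** A') \<otimes> (B ** B')"
  by (simp add: tensor_op_def matrix_matrix_mult_def vec_eq_iff sum_UNIV_prod sum_product algebra_simps)

lemma tensor_op_add_left: "(A + A') \<otimes> B = A \<otimes> B + A' \<otimes> B"
  by (simp add: tensor_op_def vec_eq_iff algebra_simps)

lemma tensor_op_add_right: "A \<otimes> (B + B') = A \<otimes> B + A \<otimes> B'"
  by (simp add: tensor_op_def vec_eq_iff algebra_simps)

lemma tensor_op_zero_left [simp]: "0 \<otimes> B = 0"
  by (simp add: tensor_op_def vec_eq_iff)

lemma tensor_op_zero_right [simp]: "A \<otimes> 0 = 0"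
  by (simp add: tensor_op_def vec_eq_iff)

lemma tensor_op_sum_left: "(\<Sum>k\<in>S. f k) \<otimes> B = (\<Sum>k\<in>S. f k \<otimes> B)"
  by (induction S rule: infinite_finite_induct) (auto simp: tensor_op_add_left)

lemma tensor_op_sum_right: "A \<otimes> (\<Sum>k\<in>S. f k) = (\<Sum>k\<in>S. A \<otimes> f k)"
  by (induction S rule: infinite_finite_induct) (auto simp: tensor_op_add_right)

lemma tensor_op_scale_left: "(c *\<^sub>C A) \<otimes> B = c *\<^sub>C (A \<otimes> B)"
  by (simp add: tensor_op_def scale_op_def vec_eq_iff)

lemma tensor_op_scale_right: "A \<otimes> (c *\<^sub>C B) = c *\<^sub>C (A \<otimes> B)"
  by (simp add: tensor_op_def scale_op_def vec_eq_iff)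

lemma trace_tensor_op: "trace (A \<otimes> B) = trace A * trace B"
  by (simp add: tensor_op_def trace_def sum_UNIV_prod sum_product)

lemma outer_tensor_vec: "outer (tensor_vec v w) (tensor_vec v' w') = outer v v' \<otimes> outer w w'"
  by (simp add: outer_def tensor_vec_def tensor_op_def vec_eq_iff)

lemma ketbra_tensor_vec: "ketbra (tensor_vec v w) = ketbra v \<otimes> ketbra w"
  by (simp add: ketbra_eq_outer outer_tensor_vec)

lemma tensor_op_mult_vec: "(A \<otimes> B) *v tensor_vec v w = tensor_vec (A *v v) (B *v w)"
  by (simp add: tensor_op_def tensor_vec_def matrix_vector_mult_def vec_eq_iff sum_UNIV_prod
      sum_product algebra_simps)

lemma cinner_tensor_vec: "cinner (tensor_vec v w) (tensor_vec v' w') = cinner v v' * cinner w w'"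
  by (simp add: cinner_def tensor_vec_def sum_UNIV_prod sum_product algebra_simps)

lemma pos_op_tensor_op:
  assumes "pos_op A" "pos_op B"
  shows "pos_op (A \<otimes> B)"
proof -
  obtain m n :: nat and v w where "A = (\<Sum>k<m. ketbra (v k))" "B = (\<Sum>k<n. ketbra (w k))"
    using pos_op_sum_ketbra assms by metis
  then show ?thesis
    by (auto simp: tensor_op_sum_left tensor_op_sum_right ketbra_tensor_vec[symmetric]
        intro!: pos_op_sum pos_op_ketbra)
qed

section \<open>Densities, partial traces and compressions\<close>

lemma pos_op_trace_mult_nonneg:
  assumes "pos_op A" "pos_op B"
  shows "0 \<le> trace (A ** B)"
proof -
  obtain n :: nat and v where "B = (\<Sum>k<n. ketbra (v k))"
    using pos_op_sum_ketbra[OF assms(2)] by blast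
  then show ?thesis
    using pos_opD[OF assms(1)]
    by (auto simp: mult_sum_left trace_sum ketbra_eq_outer mult_outer trace_outer intro!: sum_nonneg)
qed

lemma mult_add_left: "(A + B) ** D = A ** D + B ** D"
  for A B :: "complex ^ 'n ^ 'm"
  by (simp add: matrix_matrix_mult_def vec_eq_iff sum.distrib algebra_simps)

lemma mult_add_right: "D ** (A + B) = D ** A + D ** B"
  for A B :: "complex ^ 'n ^ 'm"
  by (simp add: matrix_matrix_mult_def vec_eq_iff sum.distrib algebra_simps)

lemma tensor_op_mat_1: "mat 1 \<otimes> mat 1 = mat 1"
  by (auto simp: tensor_op_def mat_def vec_eq_iff prod_eq_iff)

text \<open>Two orthonormal vectors are the columns of a square matrix \<open>U\<close> whose
  adjoint is a left inverse, hence also a right inverse.\<close>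

lemma orthonormal_complete:
  fixes e :: "bool \<Rightarrow> complex ^ 2"
  assumes "\<And>a b. cinner (e a) (e b) = of_bool (a = b)"
  shows "ketbra (e True) + ketbra (e False) = mat 1"
proof -
  define U :: "2 op" where "U = (\<chi> i j. e (j = 1) $ i)"
  define V :: "2 op" where "V = (\<chi> i j. cnj (e (i = 1) $ j))"
  have "V ** U = mat 1"
  proof -
    have "(V ** U) $ i $ j = mat 1 $ i $ j" for i j
    proof -
      have "(V ** U) $ i $ j = cinner (e (i = 1)) (e (j = 1))"
        by (simp add: V_def U_def cinner_def matrix_matrix_mult_def)
      also have "\<dots> = mat 1 $ i $ j"
        using exhaust_2[of i] exhaust_2[of j] by (auto simp: assms mat_def)
      finally show ?thesis .
    qed
    then show ?thesis by (simp add: vec_eq_iff)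
  qed
  then have "U ** V = mat 1"
    by (simp add: matrix_left_right_inverse)
  moreover have "U ** V = ketbra (e True) + ketbra (e False)"
    by (simp add: U_def V_def ketbra_def matrix_matrix_mult_def vec_eq_iff UNIV_2)
  ultimately show ?thesis by simp
qed

text \<open>Neither operator is zero, and their ranges are orthogonal. In dimension two both ranges
  are therefore lines, and the unit trace makes the operators the projections onto them.\<close>

lemma orthogonal_densities:
  fixes \<rho> :: "bool \<Rightarrow> 2 op"
  assumes pos: "\<And>x. pos_op (\<rho> x)" and tr: "\<And>x. trace (\<rho> x) = 1"
    and orth: "\<rho> False ** \<rho> True = 0"
  obtains \<phi> where "\<And>x y. cinner (\<phi> x) (\<phi> y) = of_bool (x = y)" "\<And>x. \<rho> x = ketbra (\<phi> x)"
proof -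
  have orth': "\<rho> (\<not> x) ** \<rho> x = 0" for x
  proof (cases x)
    case False
    have "trace (\<rho> True ** \<rho> False) = 0"
      using orth by (subst trace_mul_sym) (simp add: trace_def)
    then show ?thesis
      using False pos_op_trace_mult_eq_0[OF pos pos] by simp
  qed (simp add: orth)
  have "\<exists>i. \<rho> x *v axis i 1 \<noteq> 0" for x
  proof (rule ccontr)
    assume "\<nexists>i. \<rho> x *v axis i 1 \<noteq> 0"
    then have "\<rho> x = 0" by (intro op_eqI) (auto simp: matrix_vector_mult_0)
    then show False using tr[of x] by (simp add: trace_def)
  qed
  then obtain i where i: "\<And>x. \<rho> x *v axis (i x) 1 \<noteq> 0" by metis
  \<comment> \<open>A nonzero column spans the range; the vanishing product puts it into the kernel
    of the other operator.\<close>
  define \<psi> where "\<psi> = (\<lambda>x. \<rho> x *v axis (i x) 1)"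
  have nz: "\<psi> x \<noteq> 0" for x
    using i by (simp add: \<psi>_def)
  define \<phi> where "\<phi> = (\<lambda>x. of_real (1 / norm (\<psi> x)) *s \<psi> x)"
  have ker: "\<rho> (\<not> x) *v \<phi> x = 0" for x
    using orth'[of x] by (simp add: \<phi>_def \<psi>_def vector_scalar_commute matrix_vector_mul_assoc)
  have "cinner (\<psi> x) (\<psi> (\<not> x)) = 0" for x
  proof -
    have "cinner (\<psi> x) (\<psi> (\<not> x)) = cnj (cinner (axis (i (\<not> x)) 1) (\<rho> (\<not> x) *v \<psi> x))"
      unfolding \<psi>_def[THEN fun_cong, of "\<not> x"]
      by (subst pos_op_hermitian[OF pos]) simp
    then show ?thesis
      using orth'[of x] by (simp add: \<psi>_def matrix_vector_mul_assoc)
  qed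
  then have "cinner (\<phi> x) (\<phi> (\<not> x)) = 0" for x
    by (simp add: \<phi>_def cinner_scale_left cinner_scale_right)
  moreover have "cinner (\<phi> x) (\<phi> x) = 1" for x
    using nz[of x] by (simp add: \<phi>_def cinner_scale_left cinner_scale_right
        cinner_self[of "\<psi> x"] power2_eq_square)
  ultimately have on: "cinner (\<phi> x) (\<phi> y) = of_bool (x = y)" for x y
    by (cases x; cases y) (metis (full_types) of_bool_eq)+
  have 1: "\<rho> x = ketbra (\<phi> x)" for x
  proof -
    have *: "ketbra (\<phi> x) + ketbra (\<phi> (\<not> x)) = mat 1"
      using orthonormal_complete[OF on] by (cases x) (auto simp: add.commute)
    have "\<rho> x *v \<phi> x = (ketbra (\<phi> x) + ketbra (\<phi> (\<not> x))) *v (\<rho> x *v \<phi> x)"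
      by (simp add: *)
    also have "cinner (\<phi> (\<not> x)) (\<rho> x *v \<phi> x) = 0"
      using ker[of "\<not> x"] by (subst pos_op_hermitian[OF pos]) simp
    then have "(ketbra (\<phi> x) + ketbra (\<phi> (\<not> x))) *v (\<rho> x *v \<phi> x) =
        cinner (\<phi> x) (\<rho> x *v \<phi> x) *s \<phi> x"
      by (simp add: matrix_vector_mult_add_rdistrib ketbra_eq_outer outer_mult_vec)
    finally have r: "\<rho> x *v \<phi> x = cinner (\<phi> x) (\<rho> x *v \<phi> x) *s \<phi> x" .
    define c where "c = cinner (\<phi> x) (\<rho> x *v \<phi> x)"
    have "\<rho> x = \<rho> x ** (ketbra (\<phi> x) + ketbra (\<phi> (\<not> x)))"
      by (simp add: *)
    also have "\<dots> = outer (\<rho> x *v \<phi> x) (\<phi> x)"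
      using ker[of "\<not> x"]
      by (simp add: mult_add_right ketbra_eq_outer mult_outer) (simp add: outer_def vec_eq_iff)
    finally have o: "\<rho> x = outer (\<rho> x *v \<phi> x) (\<phi> x)" .
    have "c = 1"
      using tr[of x] by (subst (asm) o) (simp add: trace_outer c_def)
    then show ?thesis
      using o r by (simp add: c_def ketbra_eq_outer)
  qed
  from on 1 show ?thesis by (rule that)
qed

section \<open>Partial traces\<close>

definition ptrace1 :: "('a::finite \<times> 'b::finite) op \<Rightarrow> 'b op"
  where "ptrace1 K = (\<chi> i j. \<Sum>a\<in>UNIV. K $ (a, i) $ (a, j))"

definition ptrace2 :: "('a::finite \<times> 'b::finite) op \<Rightarrow> 'a op"
  where "ptrace2 K = (\<chi> i j. \<Sum>b\<in>UNIV. K $ (i, b) $ (j, b))"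

lemma tensor_mat_1_mult_nth:
  "((mat 1 \<otimes> B) ** K) $ p $ q = (\<Sum>r\<in>UNIV. B $ snd p $ r * K $ (fst p, r) $ q)"
proof -
  have "((mat 1 \<otimes> B) ** K) $ p $ q =
      (\<Sum>s\<in>UNIV. \<Sum>r\<in>UNIV. if s = fst p then B $ snd p $ r * K $ (fst p, r) $ q else 0)"
    unfolding matrix_matrix_mult_def tensor_op_def
    by (simp add: sum_UNIV_prod, intro sum.cong refl) (auto simp: mat_def)
  also have "\<dots> = (\<Sum>r\<in>UNIV. B $ snd p $ r * K $ (fst p, r) $ q)"
    by (subst sum.swap) simp
  finally show ?thesis .
qed

lemma mult_tensor_mat_1_nth:
  "(K ** (mat 1 \<otimes> B)) $ p $ q = (\<Sum>r\<in>UNIV. K $ p $ (fst q, r) * B $ r $ snd q)"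
proof -
  have "(K ** (mat 1 \<otimes> B)) $ p $ q =
      (\<Sum>s\<in>UNIV. \<Sum>r\<in>UNIV. if s = fst q then K $ p $ (fst q, r) * B $ r $ snd q else 0)"
    unfolding matrix_matrix_mult_def tensor_op_def
    by (simp add: sum_UNIV_prod, intro sum.cong refl) (auto simp: mat_def)
  also have "\<dots> = (\<Sum>r\<in>UNIV. K $ p $ (fst q, r) * B $ r $ snd q)"
    by (subst sum.swap) simp
  finally show ?thesis .
qed

lemma tensor_mult_mat_1_nth:
  "((A \<otimes> mat 1) ** K) $ p $ q = (\<Sum>r\<in>UNIV. A $ fst p $ r * K $ (r, snd p) $ q)"
proof -
  have "((A \<otimes> mat 1) ** K) $ p $ q =
      (\<Sum>r\<in>UNIV. \<Sum>s\<in>UNIV. if s = snd p then A $ fst p $ r * K $ (r, s) $ q else 0)"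
    unfolding matrix_matrix_mult_def tensor_op_def sum_UNIV_prod vec_lambda_beta
    by (intro sum.cong refl) (auto simp: mat_def)
  then show ?thesis by simp
qed

lemma mult_tensor_op_mat_1_nth:
  "(K ** (A \<otimes> mat 1)) $ p $ q = (\<Sum>r\<in>UNIV. K $ p $ (r, snd q) * A $ r $ fst q)"
proof -
  have "(K ** (A \<otimes> mat 1)) $ p $ q =
      (\<Sum>r\<in>UNIV. \<Sum>s\<in>UNIV. if s = snd q then K $ p $ (r, s) * A $ r $ fst q else 0)"
    unfolding matrix_matrix_mult_def tensor_op_def sum_UNIV_prod vec_lambda_beta
    by (intro sum.cong refl) (auto simp: mat_def)
  then show ?thesis by simp
qed

lemma ptrace1_mult_left: "ptrace1 ((mat 1 \<otimes> B) ** K) = B ** ptrace1 K"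
  unfolding vec_eq_iff
proof (intro allI)
  fix i j
  have "ptrace1 ((mat 1 \<otimes> B) ** K) $ i $ j = (\<Sum>a\<in>UNIV. \<Sum>r\<in>UNIV. B $ i $ r * K $ (a, r) $ (a, j))"
    by (simp add: ptrace1_def tensor_mat_1_mult_nth)
  also have "\<dots> = (B ** ptrace1 K) $ i $ j"
    by (subst sum.swap) (simp add: ptrace1_def matrix_matrix_mult_def sum_distrib_left)
  finally show "ptrace1 ((mat 1 \<otimes> B) ** K) $ i $ j = (B ** ptrace1 K) $ i $ j" .
qed

lemma ptrace1_mult_right: "ptrace1 (K ** (mat 1 \<otimes> B)) = ptrace1 K ** B"
  unfolding vec_eq_iff
proof (intro allI)
  fix i j
  have "ptrace1 (K ** (mat 1 \<otimes> B)) $ i $ j = (\<Sum>a\<in>UNIV. \<Sum>r\<in>UNIV. K $ (a, i) $ (a, r) * B $ r $ j)"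
    by (simp add: ptrace1_def mult_tensor_mat_1_nth)
  also have "\<dots> = (ptrace1 K ** B) $ i $ j"
    by (subst sum.swap) (simp add: ptrace1_def matrix_matrix_mult_def sum_distrib_right)
  finally show "ptrace1 (K ** (mat 1 \<otimes> B)) $ i $ j = (ptrace1 K ** B) $ i $ j" .
qed

lemma ptrace2_mult_left: "ptrace2 ((A \<otimes> mat 1) ** K) = A ** ptrace2 K"
  unfolding vec_eq_iff
proof (intro allI)
  fix i j
  have "ptrace2 ((A \<otimes> mat 1) ** K) $ i $ j = (\<Sum>b\<in>UNIV. \<Sum>r\<in>UNIV. A $ i $ r * K $ (r, b) $ (j, b))"
    by (simp add: ptrace2_def tensor_mult_mat_1_nth)
  also have "\<dots> = (A ** ptrace2 K) $ i $ j"
    by (subst sum.swap) (simp add: ptrace2_def matrix_matrix_mult_def sum_distrib_left)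
  finally show "ptrace2 ((A \<otimes> mat 1) ** K) $ i $ j = (A ** ptrace2 K) $ i $ j" .
qed

lemma ptrace2_mult_right: "ptrace2 (K ** (A \<otimes> mat 1)) = ptrace2 K ** A"
  unfolding vec_eq_iff
proof (intro allI)
  fix i j
  have "ptrace2 (K ** (A \<otimes> mat 1)) $ i $ j = (\<Sum>b\<in>UNIV. \<Sum>r\<in>UNIV. K $ (i, b) $ (r, b) * A $ r $ j)"
    by (simp add: ptrace2_def mult_tensor_op_mat_1_nth)
  also have "\<dots> = (ptrace2 K ** A) $ i $ j"
    by (subst sum.swap) (simp add: ptrace2_def matrix_matrix_mult_def sum_distrib_right)
  finally show "ptrace2 (K ** (A \<otimes> mat 1)) $ i $ j = (ptrace2 K ** A) $ i $ j" .
qed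

text \<open>Cyclicity survives in a partial trace for a factor that acts on the traced-out system
  alone. It allows \<open>conditional_op\<close> to be multiplied from either side.\<close>

lemma ptrace2_cyclic: "ptrace2 (K ** (mat 1 \<otimes> B)) = ptrace2 ((mat 1 \<otimes> B) ** K)"
  unfolding vec_eq_iff
proof (intro allI)
  fix i j
  have "ptrace2 (K ** (mat 1 \<otimes> B)) $ i $ j = (\<Sum>b\<in>UNIV. \<Sum>r\<in>UNIV. B $ r $ b * K $ (i, b) $ (j, r))"
    by (simp add: ptrace2_def mult_tensor_mat_1_nth mult.commute)
  also have "\<dots> = ptrace2 ((mat 1 \<otimes> B) ** K) $ i $ j"
    by (subst sum.swap) (simp add: ptrace2_def tensor_mat_1_mult_nth)
  finally show "ptrace2 (K ** (mat 1 \<otimes> B)) $ i $ j = ptrace2 ((mat 1 \<otimes> B) ** K) $ i $ j" .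
qed

lemma trace_ptrace1: "trace (ptrace1 K) = trace K"
  unfolding trace_def ptrace1_def sum_UNIV_prod by (subst sum.swap) simp

lemma trace_ptrace2: "trace (ptrace2 K) = trace K"
  by (simp add: trace_def ptrace2_def sum_UNIV_prod)

lemma ptrace2_zero [simp]: "ptrace2 0 = 0"
  by (simp add: ptrace2_def vec_eq_iff)

lemma ptrace1_zero [simp]: "ptrace1 0 = 0"
  by (simp add: ptrace1_def vec_eq_iff)

text \<open>The (unnormalised) Choi operator left to Alice when Bob obtains the outcome \<open>B\<close>.\<close>

definition conditional_op :: "'b::finite op \<Rightarrow> ('a::finite \<times> 'b) op \<Rightarrow> 'a op"
  where "conditional_op B C = ptrace2 ((mat 1 \<otimes> B) ** C)"

lemma conditional_op_nth: "conditional_op B C $ p $ p' = (\<Sum>q\<in>UNIV. \<Sum>r\<in>UNIV. B $ q $ r * C $ (p, r) $ (p', q))"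
  by (simp add: conditional_op_def ptrace2_def tensor_mat_1_mult_nth)

text \<open>Alice's factor passes through the trace over Bob's side, so a vanishing joint product
  yields a vanishing product with the operator left to Alice.\<close>

lemma mult_conditional_op: "A ** conditional_op B C = ptrace2 ((A \<otimes> B) ** C)"
  by (simp add: conditional_op_def ptrace2_mult_left[symmetric] matrix_mul_assoc tensor_op_mult)

lemma conditional_op_mult: "conditional_op B C ** A = ptrace2 (C ** (A \<otimes> B))"
  by (simp add: conditional_op_def ptrace2_cyclic[symmetric] ptrace2_mult_right[symmetric]
      matrix_mul_assoc[symmetric] tensor_op_mult)

lemma conditional_op_add: "conditional_op (B + B') C = conditional_op B C + conditional_op B' C"
  by (simp add: conditional_op_nth vec_eq_iff sum.distrib algebra_simps)

lemma trace_mult_conditional_op: "trace (A ** conditional_op B C) = trace ((A \<otimes> B) ** C)"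
  by (simp add: mult_conditional_op trace_ptrace2)

lemma trace_ketbra_mult: "trace (ketbra v ** A) = cinner v (A *v v)"
  by (subst trace_mul_sym) (simp add: ketbra_eq_outer mult_outer trace_outer)

lemma pos_op_conditional_op:
  assumes "pos_op B" "pos_op C"
  shows "pos_op (conditional_op B C)"
  unfolding pos_op_def
proof
  fix v
  have "0 \<le> trace ((ketbra v \<otimes> B) ** C)"
    using assms by (intro pos_op_trace_mult_nonneg pos_op_tensor_op pos_op_ketbra)
  then show "0 \<le> cinner v (conditional_op B C *v v)"
    by (simp add: trace_mult_conditional_op[symmetric] trace_ketbra_mult)
qed

text \<open>The matrix of the map from \<open>v\<close> to \<open>tensor_vec v \<phi>\<close>, an
  isometry when \<open>\<phi>\<close> is a unit vector. It is rectangular so that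
  \<open>compress\<close> yields an operator on the first factor only.\<close>

definition tensor_right :: "complex ^ 'i::finite \<Rightarrow> complex ^ 'a::finite ^ ('a \<times> 'i)"
  where "tensor_right \<phi> = (\<chi> p a. if fst p = a then \<phi> $ snd p else 0)"

definition tensor_right_adj :: "complex ^ 'i::finite \<Rightarrow> complex ^ ('a::finite \<times> 'i) ^ 'a"
  where "tensor_right_adj \<phi> = (\<chi> a p. if fst p = a then cnj (\<phi> $ snd p) else 0)"

lemma tensor_right_mult_vec: "tensor_right \<phi> *v v = tensor_vec v \<phi>"
proof -
  have "(\<Sum>j\<in>UNIV. (if a = j then c else 0) * v $ j) = v $ a * c" for a c
    by (subst sum.cong[OF refl, of _ _ "\<lambda>j. if a = j then v $ j * c else 0"]) auto
  then show ?thesis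
    by (simp add: tensor_right_def tensor_vec_def matrix_vector_mult_def vec_eq_iff)
qed

lemma cinner_tensor_right_adj: "cinner v (tensor_right_adj \<phi> *v w) = cinner (tensor_vec v \<phi>) w"
proof -
  have "(tensor_right_adj \<phi> *v w) $ a = (\<Sum>i\<in>UNIV. cnj (\<phi> $ i) * w $ (a, i))" for a
  proof -
    have "(tensor_right_adj \<phi> *v w) $ a =
        (\<Sum>b\<in>UNIV. \<Sum>i\<in>UNIV. if b = a then cnj (\<phi> $ i) * w $ (a, i) else 0)"
      unfolding tensor_right_adj_def matrix_vector_mult_def
      by (simp add: sum_UNIV_prod, intro sum.cong refl) auto
    also have "\<dots> = (\<Sum>i\<in>UNIV. cnj (\<phi> $ i) * w $ (a, i))"
      by (subst sum.swap) simp
    finally show ?thesis .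
  qed
  then show ?thesis
    by (simp add: cinner_def tensor_vec_def sum_UNIV_prod sum_distrib_left algebra_simps)
qed

lemma tensor_right_mult_adj: "tensor_right \<phi> ** tensor_right_adj \<phi> = mat 1 \<otimes> ketbra \<phi>"
proof -
  have "(\<Sum>k\<in>UNIV. (if a = k then c else 0) * (if b = k then d else 0)) =
      (if a = b then c * d else (0::complex))" for a b :: "'a::finite" and c d
    by (subst sum.cong[OF refl, of _ _ "\<lambda>k. if k = a then (if a = b then c * d else 0) else 0"]) auto
  then show ?thesis
    by (auto simp: tensor_right_def tensor_right_adj_def matrix_matrix_mult_def tensor_op_def ketbra_def mat_def
        vec_eq_iff)
qed

lemma tensor_right_adj_mult:
  assumes "cinner \<phi> \<phi> = 1"
  shows "tensor_right_adj \<phi> ** tensor_right \<phi> = (mat 1 :: 'a::finite op)"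
proof (rule op_eqI)
  fix i :: 'a
  have *: "cinner v ((tensor_right_adj \<phi> ** tensor_right \<phi>) *v w) = cinner v w" for v w :: "complex ^ 'a"
    by (simp add: matrix_vector_mul_assoc[symmetric] cinner_tensor_right_adj tensor_right_mult_vec cinner_tensor_vec assms)
  show "(tensor_right_adj \<phi> ** tensor_right \<phi>) *v axis i 1 = mat 1 *v axis i 1"
    using *[of "axis _ 1" "axis i 1"] by (simp add: cinner_axis vec_eq_iff)
qed

definition compress :: "complex ^ 'i::finite \<Rightarrow> ('a::finite \<times> 'i) op \<Rightarrow> 'a op"
  where "compress \<phi> X = tensor_right_adj \<phi> ** X ** tensor_right \<phi>"

lemma pos_op_compress: "pos_op X \<Longrightarrow> pos_op (compress \<phi> X)"
  by (simp add: pos_op_def compress_def matrix_vector_mul_assoc[symmetric] cinner_tensor_right_adj tensor_right_mult_vec)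

lemma compress_mult: "compress \<phi> (X ** (mat 1 \<otimes> ketbra \<phi>) ** Y) = compress \<phi> X ** compress \<phi> Y"
  by (simp add: compress_def tensor_right_mult_adj[symmetric] matrix_mul_assoc)

lemma trace_compress: "trace (compress \<phi> X) = trace ((mat 1 \<otimes> ketbra \<phi>) ** X)"
  unfolding compress_def
  by (subst trace_mul_sym) (simp add: tensor_right_mult_adj[symmetric] matrix_mul_assoc)

lemma compress_add: "compress \<phi> (X + Y) = compress \<phi> X + compress \<phi> Y"
  by (simp add: compress_def mult_add_left mult_add_right)

lemma compress_zero [simp]: "compress \<phi> 0 = 0"
  by (simp add: compress_def)

text \<open>The projection is the isometry times its adjoint. Hence an operator supported on it is
  recovered from its compression, which reduces channel measurements with pure input to operators on
  one qubit.\<close>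

lemma tensor_compress:
  "(mat 1 \<otimes> ketbra \<phi>) ** X ** (mat 1 \<otimes> ketbra \<phi>) = compress \<phi> X \<otimes> ketbra \<phi>"
  (is "?L = ?R")
proof -
  have "?R = (compress \<phi> X \<otimes> mat 1) ** (mat 1 \<otimes> ketbra \<phi>)"
    by (simp add: tensor_op_mult)
  also have "\<dots> = (compress \<phi> X \<otimes> mat 1) ** tensor_right \<phi> ** tensor_right_adj \<phi>"
    by (simp add: tensor_right_mult_adj[symmetric] matrix_mul_assoc)
  also have "(compress \<phi> X \<otimes> mat 1) ** tensor_right \<phi> = tensor_right \<phi> ** compress \<phi> X"
  proof -
    have "((Y \<otimes> mat 1) ** tensor_right \<phi>) *v v = (tensor_right \<phi> ** Y) *v v" for Y and v
      by (simp add: matrix_vector_mul_assoc[symmetric] tensor_right_mult_vec tensor_op_mult_vec)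
    then show ?thesis by (simp only: matrix_eq) blast
  qed
  also have "\<dots> ** tensor_right_adj \<phi> = ?L"
    by (simp add: compress_def tensor_right_mult_adj[symmetric] matrix_mul_assoc)
  finally show ?thesis by simp
qed

section \<open>Non-signaling boxes with perfect PR correlations\<close>

text \<open>The outcomes 1 and -1 become \<open>True\<close> and \<open>False\<close>: the product
  of two signs is 1 when the Booleans agree, and the PR condition becomes a single Boolean equation.
  The dimensions stay general so that the roles of the parties can be exchanged.\<close>

locale pr_box =
  fixes C :: "(('a::finite \<times> 'i::finite) \<times> ('b::finite \<times> 'j::finite)) op"
    and CA :: "('a \<times> 'i) op" and CB :: "('b \<times> 'j) op"
    and A :: "bool \<Rightarrow> bool \<Rightarrow> ('a \<times> 'i) op" and B :: "bool \<Rightarrow> bool \<Rightarrow> ('b \<times> 'j) op"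
    and \<sigma> :: "bool \<Rightarrow> 'i op" and \<tau> :: "bool \<Rightarrow> 'j op"
  assumes pos_C: "pos_op C"
    and trace_Aout_C: "trace_Aout C = mat 1 \<otimes> CB"
    and trace_Bout_C: "trace_Bout C = CA \<otimes> mat 1"
    and pos_A: "pos_op (A x a)" and pos_B: "pos_op (B y b)"
    and A_sum: "A x True + A x False = mat 1 \<otimes> \<sigma> x"
    and B_sum: "B y True + B y False = mat 1 \<otimes> \<tau> y"
    and density_\<sigma>: "density (\<sigma> x)" and density_\<tau>: "density (\<tau> y)"
    and prob: "trace ((A x a \<otimes> B y b) ** C) = (if (a = b) = (\<not> (x \<and> y)) then 1 / 2 else 0)"
begin

lemma A_sum': "A x a + A x (\<not> a) = mat 1 \<otimes> \<sigma> x"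
  using A_sum[of x] by (cases a) (auto simp: add.commute)

lemma impossible:
  assumes "(a = b) = (x \<and> y)"
  shows "(A x a \<otimes> B y b) ** C = 0" "C ** (A x a \<otimes> B y b) = 0"
proof -
  have "trace ((A x a \<otimes> B y b) ** C) = 0"
    using assms by (auto simp: prob)
  then show "(A x a \<otimes> B y b) ** C = 0" "C ** (A x a \<otimes> B y b) = 0"
    by (auto intro!: pos_op_trace_mult_eq_0 pos_op_tensor_op pos_A pos_B pos_C simp: trace_mul_sym[of C])
qed

abbreviation "N y b \<equiv> conditional_op (B y b) C"

lemma pos_N: "pos_op (N y b)"
  by (intro pos_op_conditional_op pos_B pos_C)

lemma A_N: "(a = b) = (x \<and> y) \<Longrightarrow> A x a ** N y b = 0"
  by (simp add: mult_conditional_op impossible)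

lemma N_A: "(a = b) = (x \<and> y) \<Longrightarrow> N y b ** A x a = 0"
  by (simp add: conditional_op_mult impossible)

text \<open>The factor \<open>mat 1\<close> discards Bob's output. What remains of \<open>C\<close>
  is the identity on Bob's input, so his input enters only through the trace of
  \<open>\<rho>\<close>: no signal reaches Alice.\<close>

lemma conditional_op_mat_1: "conditional_op (mat 1 \<otimes> \<rho>) C = trace \<rho> *\<^sub>C CA"
  unfolding vec_eq_iff
proof (intro allI)
  fix p p'
  have C: "(\<Sum>b\<in>UNIV. C $ (p, (b, j')) $ (p', (b, j))) = CA $ p $ p' * (if j' = j then 1 else 0)" for j j'
    using trace_Bout_C[unfolded vec_eq_iff, THEN spec, THEN spec, of "(p, j')" "(p', j)"]
    by (simp add: trace_Bout_def tensor_op_def mat_def)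
  have "conditional_op (mat 1 \<otimes> \<rho>) C $ p $ p' =
      (\<Sum>b\<in>UNIV. \<Sum>j\<in>UNIV. \<Sum>b'\<in>UNIV. \<Sum>j'\<in>UNIV.
        if b' = b then \<rho> $ j $ j' * C $ (p, (b, j')) $ (p', (b, j)) else 0)"
    unfolding conditional_op_nth sum_UNIV_prod by (intro sum.cong refl) (auto simp: tensor_op_def mat_def)
  also have "\<dots> = (\<Sum>b\<in>UNIV. \<Sum>j\<in>UNIV. \<Sum>j'\<in>UNIV. \<rho> $ j $ j' * C $ (p, (b, j')) $ (p', (b, j)))"
    by (intro sum.cong refl, subst sum.swap) simp
  also have "\<dots> = (\<Sum>j\<in>UNIV. \<Sum>j'\<in>UNIV. \<rho> $ j $ j' * (\<Sum>b\<in>UNIV. C $ (p, (b, j')) $ (p', (b, j))))"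
    by (subst sum.swap, intro sum.cong refl, subst sum.swap) (simp add: sum_distrib_left)
  also have "\<dots> = (\<Sum>j\<in>UNIV. \<Sum>j'\<in>UNIV. if j' = j then \<rho> $ j $ j * CA $ p $ p' else 0)"
    unfolding C by (intro sum.cong refl) auto
  finally show "conditional_op (mat 1 \<otimes> \<rho>) C $ p $ p' = (trace \<rho> *\<^sub>C CA) $ p $ p'"
    by (simp add: trace_def scale_op_def sum_distrib_right)
qed

lemma N_sum: "N y b + N y (\<not> b) = CA"
proof -
  have "B y b + B y (\<not> b) = mat 1 \<otimes> \<tau> y"
    using B_sum[of y] by (cases b) (auto simp: add.commute)
  then show ?thesis
    using density_\<tau>[of y] by (simp add: conditional_op_add[symmetric] conditional_op_mat_1 density_def)
qed

text \<open>The other direction of non-signaling: once Alice's output is discarded, Bob's statistics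
  do not depend on her input.\<close>

lemma ptrace1_conditional_op: "ptrace1 (conditional_op E C) = trace (E ** CB) *\<^sub>C mat 1"
  unfolding vec_eq_iff
proof (intro allI)
  fix i i'
  have C: "(\<Sum>a\<in>UNIV. C $ ((a, i), r) $ ((a, i'), q)) = mat 1 $ i $ i' * CB $ r $ q" for q r
    using trace_Aout_C[unfolded vec_eq_iff, THEN spec, THEN spec, of "(i, r)" "(i', q)"]
    by (simp add: trace_Aout_def tensor_op_def)
  have "ptrace1 (conditional_op E C) $ i $ i' =
      (\<Sum>q\<in>UNIV. \<Sum>r\<in>UNIV. E $ q $ r * (\<Sum>a\<in>UNIV. C $ ((a, i), r) $ ((a, i'), q)))"
    unfolding ptrace1_def conditional_op_nth vec_lambda_beta sum_distrib_left
    by (subst sum.swap, intro sum.cong refl, subst sum.swap) simp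
  also have "\<dots> = trace (E ** CB) * mat 1 $ i $ i'"
    unfolding C by (simp add: trace_def matrix_matrix_mult_def sum_distrib_left mult_ac)
  finally show "ptrace1 (conditional_op E C) $ i $ i' = (trace (E ** CB) *\<^sub>C mat 1) $ i $ i'"
    by (simp add: scale_op_def)
qed

lemma trace_S_N: "trace ((mat 1 \<otimes> \<sigma> x) ** N y b) = 1 / 2"
  by (simp add: A_sum[symmetric] mult_add_left trace_add trace_mult_conditional_op prob)

text \<open>The partial trace is already known to be scalar, and testing it on one input state
  determines the scalar. The value 1/2 is the probability of each outcome of Bob, so twice
  \<open>N y b\<close> has the normalisation of a Choi matrix.\<close>

lemma ptrace1_N: "ptrace1 (N y b) = (1 / 2) *\<^sub>C mat 1"
proof -
  have "1 / 2 = trace (\<sigma> False ** ptrace1 (N y b))"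
    using trace_S_N[of False y b] by (simp add: ptrace1_mult_left[symmetric] trace_ptrace1)
  also have "\<dots> = trace (B y b ** CB)"
    using density_\<sigma>[of False]
    by (simp add: ptrace1_conditional_op scale_op_mult_right trace_scale_op density_def)
  finally show ?thesis by (simp only: ptrace1_conditional_op)
qed

text \<open>
  Outcome \<open>True\<close> of Alice's unprimed measurement is compatible with \<open>N False True\<close> but not with
  \<open>N True False\<close>, whereas the support of \<open>\<sigma> True\<close> cannot tell \<open>N False True\<close> from \<open>N True False\<close>.
\<close>

lemma \<sigma>_orthogonal: "\<sigma> False ** \<sigma> True = 0"
proof -
  have "N False True ** (mat 1 \<otimes> \<sigma> True) = N True False ** (mat 1 \<otimes> \<sigma> True)"
  proof -
    have "N False True ** (mat 1 \<otimes> \<sigma> True) = N False True ** A True True"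
      "N True False ** (mat 1 \<otimes> \<sigma> True) = N True False ** A True True"
      by (simp_all add: A_sum[symmetric] mult_add_right N_A)
    moreover have "N False True ** A True True = CA ** A True True"
      by (simp add: mult_add_left N_A flip: N_sum[of False True])
    moreover have "N True False ** A True True = CA ** A True True"
      by (simp add: mult_add_left N_A flip: N_sum[of True False])
    ultimately show ?thesis by simp
  qed
  moreover have "(mat 1 \<otimes> \<sigma> False) ** N False True = A False True ** N False True"
    by (simp add: A_sum[symmetric] mult_add_left A_N)
  ultimately have "(mat 1 \<otimes> \<sigma> False) ** N False True ** (mat 1 \<otimes> \<sigma> True) =
      A False True ** N True False ** (mat 1 \<otimes> \<sigma> True)"
    by (metis matrix_mul_assoc)
  also have "\<dots> = 0"
    by (simp add: A_N)
  \<comment> \<open>Both outer factors act on Alice's input alone. Tracing out her output replaces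
    the middle factor by half the identity and leaves the product of the input states.\<close>
  finally have "ptrace1 ((mat 1 \<otimes> \<sigma> False) ** N False True ** (mat 1 \<otimes> \<sigma> True)) = 0"
    by simp
  then show ?thesis
    by (simp add: ptrace1_mult_left ptrace1_mult_right ptrace1_N scale_op_mult_left scale_op_mult_right
        scale_op_eq_0_iff)
qed

end

section \<open>The form of measurements on one qubit\<close>

text \<open>The choice depends on \<open>v\<close> only through its ray, so vectors from different
  settings that span the same ray become equal.\<close>

definition canonical_phase :: "complex ^ 'a::finite \<Rightarrow> complex ^ 'a"
  where "canonical_phase v = (SOME w. ketbra w = ketbra v)"

lemma ketbra_canonical_phase: "ketbra (canonical_phase v) = ketbra v"
  unfolding canonical_phase_def by (rule someI) (rule refl)

lemma canonical_phase_cong: "ketbra v = ketbra w \<Longrightarrow> canonical_phase v = canonical_phase w"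
  by (simp add: canonical_phase_def)

lemma cinner_eq_0_iff_ketbra: "cinner v w = 0 \<longleftrightarrow> ketbra v ** ketbra w = 0"
proof -
  have "ketbra v ** ketbra w = cinner v w *\<^sub>C outer v w"
    by (simp add: ketbra_eq_outer mult_outer outer_mult_vec)
      (simp add: outer_def scale_op_def vec_eq_iff)
  moreover have "outer v w = 0 \<Longrightarrow> cinner v w = 0"
  proof -
    assume "outer v w = 0"
    then have "trace (outer v w) = 0" by (simp add: trace_def)
    then show "cinner v w = 0" using cinner_commute[of v w] by (simp add: trace_outer)
  qed
  ultimately show ?thesis by (auto simp: scale_op_eq_0_iff)
qed

locale pr_box_qubit = pr_box C CA CB A B \<sigma> \<tau>
  for C :: "((2 \<times> 2) \<times> ('b::finite \<times> 'j::finite)) op" and CA CB A B \<sigma> \<tau>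
begin

text \<open>The input states are orthogonal and pure, so each effect lives on one input vector and
  reduces to an effect on the output qubit. Conditioning on Bob's outcome gives operators that these
  effects discriminate perfectly, which in dimension two forces rank-one projections.\<close>

lemma measurement_form:
  obtains \<phi> e where
    "\<And>x x'. cinner (\<phi> x) (\<phi> x') = of_bool (x = x')"
    "\<And>x a a'. cinner (e x a) (e x a') = of_bool (a = a')"
    "\<And>x a. A x a = ketbra (tensor_vec (e x a) (\<phi> x))"
    "\<And>x a x' a'. cinner (e x a) (e x' a') = 0 \<Longrightarrow> e x' a' = e x (\<not> a)"
proof -
  obtain \<phi> where on: "\<And>x y. cinner (\<phi> x) (\<phi> y) = of_bool (x = y)"
    and \<sigma>: "\<And>x. \<sigma> x = ketbra (\<phi> x)"
    using orthogonal_densities[OF _ _ \<sigma>_orthogonal] density_\<sigma> by (auto simp: density_def)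
  define P where "P = (\<lambda>x. mat 1 \<otimes> ketbra (\<phi> x) :: (2 \<times> 2) op)"
  have P_sum: "P x + P (\<not> x) = mat 1" for x
    using orthonormal_complete[OF on]
    by (cases x) (auto simp: P_def tensor_op_add_right[symmetric] tensor_op_mat_1 add.commute)
  have posP: "pos_op (P x)" for x
    by (simp add: P_def pos_op_tensor_op pos_op_mat_1 pos_op_ketbra)
  \<comment> \<open>The two effects of a setting sum to an operator orthogonal to the other
    projection. Their traces against it are nonnegative with sum zero, hence vanish one by
    one.\<close>
  have AP0: "A x a ** P (\<not> x) = 0" and PA0: "P (\<not> x) ** A x a = 0" for x a
  proof -
    have "(A x a + A x (\<not> a)) ** P (\<not> x) = 0"
      using cinner_eq_0_iff_ketbra[of "\<phi> x" "\<phi> (\<not> x)"]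
      by (simp add: A_sum' P_def \<sigma> tensor_op_mult on)
    then have "trace (A x a ** P (\<not> x)) + trace (A x (\<not> a) ** P (\<not> x)) = 0"
      by (simp add: mult_add_left trace_add[symmetric]) (simp add: trace_def)
    then have "trace (A x a ** P (\<not> x)) = 0"
      using pos_op_trace_mult_nonneg[OF pos_A posP] by (metis add_nonneg_eq_0_iff)
    then show "A x a ** P (\<not> x) = 0" "P (\<not> x) ** A x a = 0"
      using pos_op_trace_mult_eq_0 pos_A posP trace_mul_sym by metis+
  qed
  have AP: "A x a ** P x = A x a" and PA: "P x ** A x a = A x a" for x a
    using P_sum[of x] AP0[of x a] PA0[of x a]
    by (metis add.right_neutral mult_add_right matrix_mul_rid,
        metis add.right_neutral mult_add_left matrix_mul_lid)
  define m where "m = (\<lambda>x a. compress (\<phi> x) (A x a))"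
  \<comment> \<open>Against Bob's unprimed setting the outcomes must agree for both values of
    \<open>x\<close>, so one pair of conditional operators serves both of Alice's
    measurements.\<close>
  define n where "n = (\<lambda>x a. compress (\<phi> x) (N False a))"
  have m_sum: "m x True + m x False = mat 1" for x
  proof -
    have "m x True + m x False = compress (\<phi> x) (P x)"
      by (simp add: m_def compress_add[symmetric] A_sum P_def \<sigma>)
    also have "\<dots> = (tensor_right_adj (\<phi> x) ** tensor_right (\<phi> x)) ** (tensor_right_adj (\<phi> x) ** tensor_right (\<phi> x))"
      by (simp add: P_def compress_def tensor_right_mult_adj[symmetric] matrix_mul_assoc)
    also have "\<dots> = mat 1"
      by (simp add: tensor_right_adj_mult on)
    finally show ?thesis .
  qed
  have mn: "m x (\<not> a) ** n x a = 0" and nm: "n x a ** m x (\<not> a) = 0" for x a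
    using compress_mult[of "\<phi> x" "A x (\<not> a)" "N False a"]
      compress_mult[of "\<phi> x" "N False a" "A x (\<not> a)"]
      AP[of x "\<not> a"] PA[of x "\<not> a"]
    by (simp_all add: m_def n_def P_def A_N N_A flip: matrix_mul_assoc)
      (simp add: matrix_mul_assoc A_N)
  \<comment> \<open>The inserted identity is the sum of two effects: the first is annihilated from
    the left, the second from the right.\<close>
  have nn: "n x False ** n x True = 0" for x
  proof -
    have "n x False ** n x True = n x False ** (m x True + m x False) ** n x True"
      by (simp add: m_sum)
    also have "\<dots> = n x False ** m x True ** n x True + n x False ** (m x False ** n x True)"
      by (simp add: mult_add_left mult_add_right matrix_mul_assoc)
    finally show ?thesis
      using nm[of x False] mn[of x True] by simp
  qed
  \<comment> \<open>The factor 2 compensates the probability 1/2 of Bob's outcome and produces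
    densities.\<close>
  have "\<exists>f. (\<forall>a a'. cinner (f a) (f a') = of_bool (a = a')) \<and> (\<forall>a. 2 *\<^sub>C n x a = ketbra (f a))" for x
  proof -
    have "pos_op (2 *\<^sub>C n x a)" for a
      unfolding n_def by (intro pos_op_scale pos_op_compress pos_N) (simp add: less_eq_complex_def)
    moreover have "trace (2 *\<^sub>C n x a) = 1" for a
      using trace_S_N[of x False a] by (simp only: trace_scale_op n_def trace_compress \<sigma>) simp
    moreover have "2 *\<^sub>C n x False ** 2 *\<^sub>C n x True = 0"
      by (simp add: scale_op_mult_left scale_op_mult_right nn scale_op_eq_0_iff)
    ultimately obtain f where "\<And>a a'. cinner (f a) (f a') = of_bool (a = a')"
      "\<And>a. 2 *\<^sub>C n x a = ketbra (f a)"
      using orthogonal_densities[of "\<lambda>a. 2 *\<^sub>C n x a"] by blast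
    then show ?thesis by blast
  qed
  then obtain f where f_on: "\<And>x a a'. cinner (f x a) (f x a') = of_bool (a = a')"
    and n_f: "\<And>x a. 2 *\<^sub>C n x a = ketbra (f x a)"
    by metis
  \<comment> \<open>Each effect annihilates one basis vector, and the two sum to the identity; so
    each fixes the other basis vector.\<close>
  have m_f: "m x a = ketbra (f x a)" for x a
  proof -
    have mf: "m x (\<not> a) ** ketbra (f x a) = 0" for a
      using mn[of x a] by (simp add: n_f[symmetric] scale_op_mult_right scale_op_eq_0_iff)
    have f_sum: "ketbra (f x a) + ketbra (f x (\<not> a)) = mat 1"
      using orthonormal_complete[OF f_on] by (cases a) (auto simp: add.commute)
    have ma: "m x a + m x (\<not> a) = mat 1"
      using m_sum[of x] by (cases a) (auto simp: add.commute)
    have "m x a = m x a ** (ketbra (f x a) + ketbra (f x (\<not> a)))"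
      by (simp add: f_sum)
    also have "\<dots> = m x a ** ketbra (f x a)"
      using mf[of "\<not> a"] by (simp add: mult_add_right)
    also have "\<dots> = (m x a + m x (\<not> a)) ** ketbra (f x a)"
      using mf[of a] by (simp add: mult_add_left)
    finally show ?thesis by (simp add: ma)
  qed
  define e where "e = (\<lambda>x a. canonical_phase (f x a))"
  have kb: "ketbra (e x a) = ketbra (f x a)" for x a
    by (simp add: e_def ketbra_canonical_phase)
  show thesis
  proof
    show "cinner (\<phi> x) (\<phi> x') = of_bool (x = x')" for x x'
      by (rule on)
    have norm1: "cinner (e x a) (e x a) = 1" for x a
      using arg_cong[OF kb[of x a], of trace] by (simp add: ketbra_eq_outer trace_outer f_on)
    have e_on: "cinner (e x a) (e x a') = of_bool (a = a')" for x a a'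
      using cinner_eq_0_iff_ketbra[of "f x a" "f x a'"] cinner_eq_0_iff_ketbra[of "e x a" "e x a'"]
      by (cases "a = a'") (auto simp: norm1 kb f_on)
    then show "cinner (e x a) (e x a') = of_bool (a = a')" for x a a' .
    show "A x a = ketbra (tensor_vec (e x a) (\<phi> x))" for x a
    proof -
      have "A x a = P x ** A x a ** P x"
        by (simp add: AP PA)
      also have "\<dots> = m x a \<otimes> ketbra (\<phi> x)"
        unfolding P_def m_def by (rule tensor_compress)
      finally show ?thesis by (simp add: ketbra_tensor_vec kb m_f)
    qed
    show "e x' a' = e x (\<not> a)" if "cinner (e x a) (e x' a') = 0" for x a x' a'
    proof -
      define c where "c = cinner (e x (\<not> a)) (e x' a')"
      have "ketbra (e x a) + ketbra (e x (\<not> a)) = mat 1"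
        using orthonormal_complete[OF e_on[of x]] by (cases a) (auto simp: add.commute)
      then have "e x' a' = (ketbra (e x a) + ketbra (e x (\<not> a))) *v e x' a'"
        by simp
      then have eq: "e x' a' = c *s e x (\<not> a)"
        using that by (simp add: matrix_vector_mult_add_rdistrib ketbra_eq_outer outer_mult_vec c_def)
      then have "c * cnj c = 1"
        using norm1[of x' a'] by (simp add: cinner_scale_left cinner_scale_right norm1)
      \<comment> \<open>The coefficient \<open>c\<close> has modulus one, so the rays agree; the
        canonical representative then gives equality of vectors.\<close>
      then have "ketbra (e x' a') = ketbra (e x (\<not> a))"
        unfolding eq by (simp add: ketbra_def vec_eq_iff)
      then have "ketbra (f x' a') = ketbra (f x (\<not> a))"
        by (simp add: kb)
      then show ?thesis
        unfolding e_def by (rule canonical_phase_cong)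
    qed
  qed
qed

end

section \<open>Non-signaling for matrix entries between different settings\<close>

lemma sum_bool: "(\<Sum>b\<in>UNIV. g b) = g True + g False"
  for g :: "bool \<Rightarrow> 'c::comm_monoid_add"
  by (simp add: UNIV_bool add.commute)

lemma sum_bool_at: "(\<Sum>b\<in>UNIV. g b) = g a + g (\<not> a)"
  for g :: "bool \<Rightarrow> 'c::comm_monoid_add"
  by (cases a) (simp_all add: UNIV_bool add.commute)

lemma sum_bool2_at:
  "(\<Sum>c\<in>UNIV. \<Sum>c'\<in>UNIV. g c c') = g a a' + g a (\<not> a') + (g (\<not> a) a' + g (\<not> a) (\<not> a'))"
  for g :: "bool \<Rightarrow> bool \<Rightarrow> 'c::comm_monoid_add"
  by (subst sum_bool_at[of _ a], subst (1 2) sum_bool_at[of _ a']) (rule refl)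

lemma cinner_eq_trace: "cinner v (C *v w) = trace (outer w v ** C)"
  by (subst trace_mul_sym) (simp add: mult_outer trace_outer)

text \<open>The product of two resolutions of the identity, expanded. It lets the two sides of a
  matrix entry use different output bases while the sum is still an output trace.\<close>

lemma tensor_vec_outer_sum:
  fixes e e' :: "bool \<Rightarrow> complex ^ 'a::finite"
  assumes "ketbra (e True) + ketbra (e False) = mat 1" "ketbra (e' True) + ketbra (e' False) = mat 1"
  shows "(\<Sum>a\<in>UNIV. \<Sum>a'\<in>UNIV. cinner (e' a') (e a) *\<^sub>C outer (e' a') (e a)) = mat 1"
proof -
  have *: "cinner (e' a') (e a) *\<^sub>C outer (e' a') (e a) = ketbra (e' a') ** ketbra (e a)" for a a'
    by (simp add: ketbra_eq_outer mult_outer outer_mult_vec)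
      (simp add: outer_def scale_op_def vec_eq_iff)
  have "(ketbra (e' True) + ketbra (e' False)) ** (ketbra (e True) + ketbra (e False)) = mat 1"
    by (simp add: assms)
  then show ?thesis
    unfolding * by (simp add: UNIV_bool mult_add_left mult_add_right add_ac)
qed

context pr_box
begin

text \<open>The weighted sum inserts the identity on Alice's output and so traces it out; her input
  vectors then contribute only their inner product. The sum vanishes for orthogonal inputs and is
  the same for every common unit input.\<close>

lemma nonsignaling_A:
  assumes "ketbra (e True) + ketbra (e False) = mat 1" "ketbra (e' True) + ketbra (e' False) = mat 1"
  shows "(\<Sum>a\<in>UNIV. \<Sum>a'\<in>UNIV. cinner (e' a') (e a) *
      cinner (tensor_vec (tensor_vec (e a) \<xi>) w) (C *v tensor_vec (tensor_vec (e' a') \<xi>') w')) =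
    cinner \<xi> \<xi>' * cinner w (CB *v w')" (is "?L = _")
proof -
  let ?M = "\<Sum>a\<in>UNIV. \<Sum>a'\<in>UNIV. cinner (e' a') (e a) *\<^sub>C outer (e' a') (e a)"
  have "?L = trace (((?M \<otimes> outer \<xi>' \<xi>) \<otimes> outer w' w) ** C)"
    by (simp add: cinner_eq_trace outer_tensor_vec UNIV_bool tensor_op_add_left tensor_op_scale_left
        mult_add_left trace_add scale_op_mult_left trace_scale_op)
  also have "\<dots> = trace (ptrace1 ((mat 1 \<otimes> outer \<xi>' \<xi>) ** conditional_op (outer w' w) C))"
    by (simp only: tensor_vec_outer_sum[OF assms] trace_ptrace1 trace_mult_conditional_op)
  also have "\<dots> = cinner \<xi> \<xi>' * cinner w (CB *v w')"
    by (simp add: ptrace1_mult_left ptrace1_conditional_op scale_op_mult_right trace_scale_op trace_outer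
        cinner_eq_trace)
  finally show ?thesis .
qed

lemma nonsignaling_B:
  assumes "ketbra (f True) + ketbra (f False) = mat 1" "ketbra (f' True) + ketbra (f' False) = mat 1"
  shows "(\<Sum>b\<in>UNIV. \<Sum>b'\<in>UNIV. cinner (f' b') (f b) *
      cinner (tensor_vec v (tensor_vec (f b) \<zeta>)) (C *v tensor_vec v' (tensor_vec (f' b') \<zeta>'))) =
    cinner \<zeta> \<zeta>' * cinner v (CA *v v')" (is "?L = _")
proof -
  let ?M = "\<Sum>b\<in>UNIV. \<Sum>b'\<in>UNIV. cinner (f' b') (f b) *\<^sub>C outer (f' b') (f b)"
  have "?L = trace ((outer v' v \<otimes> (?M \<otimes> outer \<zeta>' \<zeta>)) ** C)"
    by (simp add: cinner_eq_trace outer_tensor_vec UNIV_bool tensor_op_add_left tensor_op_add_right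
        tensor_op_scale_left tensor_op_scale_right
        mult_add_left trace_add scale_op_mult_left trace_scale_op)
  also have "\<dots> = trace (outer v' v ** conditional_op (mat 1 \<otimes> outer \<zeta>' \<zeta>) C)"
    by (simp only: tensor_vec_outer_sum[OF assms] trace_mult_conditional_op)
  also have "\<dots> = cinner \<zeta> \<zeta>' * cinner v (CA *v v')"
    by (simp add: conditional_op_mat_1 scale_op_mult_right trace_scale_op trace_outer cinner_eq_trace)
  finally show ?thesis .
qed

end

section \<open>Exchange of the two parties\<close>

definition swap_op :: "('a::finite \<times> 'b::finite) op \<Rightarrow> ('b \<times> 'a) op"
  where "swap_op K = (\<chi> p q. K $ prod.swap p $ prod.swap q)"

lemma sum_swap_UNIV: "(\<Sum>p\<in>UNIV. g (prod.swap p)) = (\<Sum>p\<in>UNIV. g p)"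
  for g :: "'a::finite \<times> 'b::finite \<Rightarrow> 'c::comm_monoid_add"
  by (simp add: sum_UNIV_prod) (rule sum.swap)

lemma swap_op_tensor_op: "swap_op (A \<otimes> B) = B \<otimes> A"
  by (simp add: swap_op_def tensor_op_def vec_eq_iff)

lemma swap_op_mult: "swap_op (K ** L) = swap_op K ** swap_op L"
  by (simp add: swap_op_def matrix_matrix_mult_def vec_eq_iff
      sum_swap_UNIV[where g = "\<lambda>p. K $ _ $ p * L $ p $ _"])

lemma trace_swap_op: "trace (swap_op K) = trace K"
  by (simp add: trace_def swap_op_def sum_swap_UNIV[where g = "\<lambda>p. K $ p $ p"])

lemma pos_op_swap_op:
  fixes K :: "('a::finite \<times> 'b::finite) op"
  assumes "pos_op K"
  shows "pos_op (swap_op K)"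
  unfolding swap_op_def by (rule pos_op_reindex[OF assms bij_swap])

text \<open>The PR pattern is symmetric in the parties, so what is shown for a qubit on Alice's side
  transfers to Bob's.\<close>

lemma (in pr_box) pr_box_swap: "pr_box (swap_op C) CB CA B A \<tau> \<sigma>"
proof
  show "pos_op (swap_op C)" by (rule pos_op_swap_op[OF pos_C])
  show "trace_Aout (swap_op C) = mat 1 \<otimes> CA"
    using trace_Bout_C by (simp add: trace_Aout_def trace_Bout_def swap_op_def tensor_op_def vec_eq_iff)
  show "trace_Bout (swap_op C) = CB \<otimes> mat 1"
    using trace_Aout_C by (simp add: trace_Aout_def trace_Bout_def swap_op_def tensor_op_def vec_eq_iff)
  show "trace ((B x a \<otimes> A y b) ** swap_op C) = (if (a = b) = (\<not> (x \<and> y)) then 1 / 2 else 0)"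
    for x a y b
  proof -
    have "trace ((B x a \<otimes> A y b) ** swap_op C) = trace (swap_op ((A y b \<otimes> B x a) ** C))"
      by (simp only: swap_op_tensor_op swap_op_mult)
    then show ?thesis
      using prob[of y b x a] by (auto simp: trace_swap_op)
  qed
qed (auto simp: pos_A pos_B A_sum B_sum density_\<sigma> density_\<tau>)

lemma cinner_sum_left: "cinner (\<Sum>k\<in>S. v k) w = (\<Sum>k\<in>S. cinner (v k) w)"
  by (induction S rule: infinite_finite_induct) (auto simp: cinner_add_left)

lemma mult_sum_right: "(\<Sum>k\<in>S. f k) ** A = (\<Sum>k\<in>S. f k ** A)"
  for f :: "'k \<Rightarrow> 'a::finite op"
  by (induction S rule: infinite_finite_induct) (auto simp: mult_add_left)

locale pr_box_qubits = pr_box C CA CB A B \<sigma> \<tau>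
  for C :: "((2 \<times> 2) \<times> (2 \<times> 2)) op" and CA CB A B \<sigma> \<tau>
begin

sublocale alice: pr_box_qubit C CA CB A B \<sigma> \<tau> ..

sublocale bob: pr_box_qubit "swap_op C" CB CA B A \<tau> \<sigma>
  unfolding pr_box_qubit_def by (rule pr_box_swap)

text \<open>
  For inputs \<open>i = (x, y)\<close> and Alice's outcome \<open>a\<close>, Bob's outcome is forced to be \<open>a \<noteq> (x \<and> y)\<close>.
\<close>

lemma choi_expansion:
  obtains e f :: "bool \<Rightarrow> bool \<Rightarrow> complex ^ 2" and \<phi> \<kappa> :: "bool \<Rightarrow> complex ^ 2"
    and c :: "((bool \<times> bool) \<times> bool) op"
  where
    "\<And>x a a'. cinner (e x a) (e x a') = of_bool (a = a')"
    "\<And>y b b'. cinner (f y b) (f y b') = of_bool (b = b')"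
    "\<And>x a x' a'. cinner (e x a) (e x' a') = 0 \<Longrightarrow> e x' a' = e x (\<not> a)"
    "\<And>y b y' b'. cinner (f y b) (f y' b') = 0 \<Longrightarrow> f y' b' = f y (\<not> b)"
    "\<And>x x'. cinner (\<phi> x) (\<phi> x') = of_bool (x = x')"
    "\<And>y y'. cinner (\<kappa> y) (\<kappa> y') = of_bool (y = y')"
    "pos_op c" "\<And>s. c $ s $ s = 1 / 2"
    "\<And>x y a x' y' a'. c $ ((x, y), a) $ ((x', y'), a') \<noteq> 0 \<Longrightarrow> ((x, y), a) \<noteq> ((x', y'), a') \<Longrightarrow>
      cinner (e x a) (e x' a') = 0 \<and> cinner (f y (a \<noteq> (x \<and> y))) (f y' (a' \<noteq> (x' \<and> y'))) = 0"
    "C = (\<Sum>((x, y), a)\<in>UNIV. \<Sum>((x', y'), a')\<in>UNIV. c $ ((x, y), a) $ ((x', y'), a') *\<^sub>C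
      outer (tensor_vec (tensor_vec (e x a) (\<phi> x)) (tensor_vec (f y (a \<noteq> (x \<and> y))) (\<kappa> y)))
        (tensor_vec (tensor_vec (e x' a') (\<phi> x')) (tensor_vec (f y' (a' \<noteq> (x' \<and> y'))) (\<kappa> y'))))"
proof -
  obtain \<phi> e where \<phi>: "\<And>x x'. cinner (\<phi> x) (\<phi> x') = of_bool (x = x')"
    and e: "\<And>x a a'. cinner (e x a) (e x a') = of_bool (a = a')"
    and A: "\<And>x a. A x a = ketbra (tensor_vec (e x a) (\<phi> x))"
    and e_perp: "\<And>x a x' a'. cinner (e x a) (e x' a') = 0 \<Longrightarrow> e x' a' = e x (\<not> a)"
    apply (rule alice.measurement_form)
    subgoal premises p by (rule p(1)) (fact p(2-))+
    done
  obtain \<kappa> f where \<kappa>: "\<And>y y'. cinner (\<kappa> y) (\<kappa> y') = of_bool (y = y')"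
    and f: "\<And>y b b'. cinner (f y b) (f y b') = of_bool (b = b')"
    and B: "\<And>y b. B y b = ketbra (tensor_vec (f y b) (\<kappa> y))"
    and f_perp: "\<And>y b y' b'. cinner (f y b) (f y' b') = 0 \<Longrightarrow> f y' b' = f y (\<not> b)"
    apply (rule bob.measurement_form)
    subgoal premises p by (rule p(1)) (fact p(2-))+
    done
  define P where "P = (\<lambda>x a y b. tensor_vec (tensor_vec (e x a) (\<phi> x)) (tensor_vec (f y b) (\<kappa> y)))"
  define G where "G = (\<lambda>x a y b x' a' y' b'. cinner (P x a y b) (C *v P x' a' y' b'))"
  have AB: "A x a \<otimes> B y b = ketbra (P x a y b)" for x a y b
    by (simp add: A B P_def ketbra_tensor_vec)
  have norm_P: "cinner (P x a y b) (P x a y b) = 1" for x a y b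
    by (simp add: P_def cinner_tensor_vec e f \<phi> \<kappa>)
  \<comment> \<open>A forbidden product vector has probability zero, so \<open>C\<close> annihilates
    it and not only the quadratic form does.\<close>
  have CP: "C *v P x a y b = 0" if "(a = b) = (x \<and> y)" for x a y b
  proof -
    have "C *v P x a y b = (C ** ketbra (P x a y b)) *v P x a y b"
      by (simp add: matrix_vector_mul_assoc[symmetric] ketbra_eq_outer outer_mult_vec norm_P)
    then show ?thesis using impossible(2)[OF that] by (simp add: AB)
  qed
  have G0: "G x a y b x' a' y' b' = 0" if "(a = b) = (x \<and> y) \<or> (a' = b') = (x' \<and> y')"
    for x a y b x' a' y' b'
    using that
  proof
    assume "(a = b) = (x \<and> y)"
    then have "cinner (P x' a' y' b') (C *v P x a y b) = 0" by (simp only: CP cinner_zero_right)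
    then show ?thesis
      unfolding G_def by (subst pos_op_hermitian[OF pos_C]) simp
  next
    assume "(a' = b') = (x' \<and> y')"
    then show ?thesis by (simp only: G_def CP cinner_zero_right)
  qed
  have G_diag: "G x a y b x a y b = 1 / 2" if "(a = b) = (\<not> (x \<and> y))" for x a y b
    using prob[of x a y b] by (simp only: that AB trace_ketbra_mult G_def if_True refl)
  have e_c: "ketbra (e x True) + ketbra (e x False) = mat 1" for x
    by (rule orthonormal_complete) (rule e)
  have f_c: "ketbra (f y True) + ketbra (f y False) = mat 1" for y
    by (rule orthonormal_complete) (rule f)
  have NA: "(\<Sum>a\<in>UNIV. \<Sum>a'\<in>UNIV. cinner (e x' a') (e x a) * G x a y b x' a' y' b') =
      of_bool (x = x') * cinner (tensor_vec (f y b) (\<kappa> y)) (CB *v tensor_vec (f y' b') (\<kappa> y'))"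
    for x x' y b y' b'
    unfolding G_def P_def by (subst nonsignaling_A[OF e_c e_c]) (simp add: \<phi>)
  have NB: "(\<Sum>b\<in>UNIV. \<Sum>b'\<in>UNIV. cinner (f y' b') (f y b) * G x a y b x' a' y' b') =
      of_bool (y = y') * cinner (tensor_vec (e x a) (\<phi> x)) (CA *v tensor_vec (e x' a') (\<phi> x'))"
    for x a x' a' y y'
    unfolding G_def P_def by (subst nonsignaling_B[OF f_c f_c]) (simp add: \<kappa>)
  have allowed: "(a = b) \<noteq> (x \<and> y)" "(a' = b') \<noteq> (x' \<and> y')" if "G x a y b x' a' y' b' \<noteq> 0"
    for x a y b x' a' y' b'
    by (metis G0 that)+
  \<comment> \<open>With Bob's outcomes fixed, the pattern forces Alice's, and the double sum has
    one term. Her inputs are orthogonal, so this term is zero; since the entry is not, the overlap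
    of the output vectors is.\<close>
  have e_orth: "cinner (e x a) (e x' a') = 0"
    if "x \<noteq> x'" "G x a y b x' a' y' b' \<noteq> 0" for x a y b x' a' y' b'
  proof -
    have z: "G x c y b x' c' y' b' = 0" if "c = (\<not> a) \<or> c' = (\<not> a')" for c c'
      by (rule G0) (use allowed[OF \<open>G x a y b x' a' y' b' \<noteq> 0\<close>] that in argo)
    have "0 = (\<Sum>c\<in>UNIV. \<Sum>c'\<in>UNIV. cinner (e x' c') (e x c) * G x c y b x' c' y' b')"
      using NA[of x' x y b y' b'] that(1) by simp
    also have "\<dots> = cinner (e x' a') (e x a) * G x a y b x' a' y' b'"
      by (subst sum_bool2_at[of _ a a']) (simp add: z)
    finally show ?thesis
      using that(2) by (subst cinner_commute) simp
  qed
  have f_orth: "cinner (f y b) (f y' b') = 0"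
    if "y \<noteq> y'" "G x a y b x' a' y' b' \<noteq> 0" for x a y b x' a' y' b'
  proof -
    have z: "G x a y c x' a' y' c' = 0" if "c = (\<not> b) \<or> c' = (\<not> b')" for c c'
      by (rule G0) (use allowed[OF \<open>G x a y b x' a' y' b' \<noteq> 0\<close>] that in argo)
    have "0 = (\<Sum>c\<in>UNIV. \<Sum>c'\<in>UNIV. cinner (f y' c') (f y c) * G x a y c x' a' y' c')"
      using NB[of y' y x a x' a'] that(1) by simp
    also have "\<dots> = cinner (f y' b') (f y b) * G x a y b x' a' y' b'"
      by (subst sum_bool2_at[of _ b b']) (simp add: z)
    finally show ?thesis
      using that(2) by (subst cinner_commute) simp
  qed
  \<comment> \<open>The entry summed over a common outcome of Bob is the same for both values of
    \<open>y\<close>. If \<open>b = b'\<close>, switching \<open>y\<close> alters exactly one of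
    \<open>x \<and> y\<close> and \<open>x' \<and> y\<close>; the outcomes forced on the two sides
    then differ and every term of the new sum vanishes.\<close>
  have f_orth': "b \<noteq> b'" if "x \<noteq> x'" "G x a y b x' a' y b' \<noteq> 0" for x a y b x' a' b'
  proof
    assume "b = b'"
    note al = allowed[OF that(2)]
    have "(\<Sum>c\<in>UNIV. G x a y c x' a' y c) = (\<Sum>c\<in>UNIV. G x a (\<not> y) c x' a' (\<not> y) c)"
      using NB[of y y x a x' a'] NB[of "\<not> y" "\<not> y" x a x' a'] by (simp add: sum_bool f)
    moreover have "G x a y (\<not> b) x' a' y (\<not> b) = 0"
      by (rule G0) (use al in argo)
    then have "(\<Sum>c\<in>UNIV. G x a y c x' a' y c) = G x a y b x' a' y b"
      by (subst sum_bool_at[of _ b]) simp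
    moreover have "G x a (\<not> y) c x' a' (\<not> y) c = 0" for c
      by (rule G0) (use al that(1) \<open>b = b'\<close> in argo)
    ultimately show False using that \<open>b = b'\<close> by simp
  qed
  have e_orth': "a \<noteq> a'" if "y \<noteq> y'" "G x a y b x a' y' b' \<noteq> 0" for x a y b a' y' b'
  proof
    assume "a = a'"
    note al = allowed[OF that(2)]
    have "(\<Sum>c\<in>UNIV. G x c y b x c y' b') = (\<Sum>c\<in>UNIV. G (\<not> x) c y b (\<not> x) c y' b')"
      using NA[of x x y b y' b'] NA[of "\<not> x" "\<not> x" y b y' b'] by (simp add: sum_bool e)
    moreover have "G x (\<not> a) y b x (\<not> a) y' b' = 0"
      by (rule G0) (use al in argo)
    then have "(\<Sum>c\<in>UNIV. G x c y b x c y' b') = G x a y b x a y' b'"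
      by (subst sum_bool_at[of _ a]) simp
    moreover have "G (\<not> x) c y b (\<not> x) c y' b' = 0" for c
      by (rule G0) (use al that(1) \<open>a = a'\<close> in argo)
    ultimately show False using that \<open>a = a'\<close> by simp
  qed
  define Q where "Q = (\<lambda>((x, y), a). P x a y (a \<noteq> (x \<and> y)))"
  define c :: "((bool \<times> bool) \<times> bool) op" where "c = (\<chi> s s'. cinner (Q s) (C *v Q s'))"
  have c_G: "c $ ((x, y), a) $ ((x', y'), a') = G x a y (a \<noteq> (x \<and> y)) x' a' y' (a' \<noteq> (x' \<and> y'))"
    for x y a x' y' a'
    by (simp add: c_def Q_def G_def)
  show thesis
  proof
    show "c $ s $ s = 1 / 2" for s
    proof -
      obtain x y a where s: "s = ((x, y), a)" by (metis surj_pair)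
      show ?thesis unfolding s c_G by (rule G_diag) argo
    qed
    show "pos_op c"
      unfolding pos_op_def
    proof
      fix v
      define w where "w = (\<Sum>s\<in>UNIV. v $ s *s Q s)"
      have "cinner w (C *v w) = (\<Sum>s\<in>UNIV. \<Sum>s'\<in>UNIV. cnj (v $ s) * (v $ s' * cinner (Q s) (C *v Q s')))"
        by (subst sum.swap) (simp add: w_def mult_vec_sum cinner_sum_left cinner_sum_right
            cinner_scale_left cinner_scale_right vector_scalar_commute sum_distrib_left mult_ac)
      moreover have "(c *v v) $ s = (\<Sum>s'\<in>UNIV. v $ s' * cinner (Q s) (C *v Q s'))" for s
        unfolding matrix_vector_mult_def[of c] by (simp add: c_def mult.commute)
      ultimately have "cinner v (c *v v) = cinner w (C *v w)"
        by (simp add: cinner_def[of v] sum_distrib_left)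
      then show "0 \<le> cinner v (c *v v)"
        using pos_opD[OF pos_C] by simp
    qed
    show "cinner (e x a) (e x' a') = 0 \<and> cinner (f y (a \<noteq> (x \<and> y))) (f y' (a' \<noteq> (x' \<and> y'))) = 0"
      if "c $ ((x, y), a) $ ((x', y'), a') \<noteq> 0" "((x, y), a) \<noteq> ((x', y'), a')" for x y a x' y' a'
    proof -
      let ?b = "a \<noteq> (x \<and> y)" and ?b' = "a' \<noteq> (x' \<and> y')"
      have G: "G x a y ?b x' a' y' ?b' \<noteq> 0"
        using that(1) by (simp only: c_G not_False_eq_True)
      have "cinner (e x a) (e x' a') = 0"
      proof (cases "x = x'")
        case True
        have "a \<noteq> a'"
        proof (cases "y = y'")
          case False
          then show ?thesis using e_orth' G True by blast
        qed (use True that in auto)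
        then show ?thesis using True by (simp add: e)
      qed (use e_orth G in blast)
      moreover have "cinner (f y ?b) (f y' ?b') = 0"
      proof (cases "y = y'")
        case True
        have "?b \<noteq> ?b'"
        proof (cases "x = x'")
          case False
          then show ?thesis using f_orth' G True by blast
        qed (use True that in auto)
        then show ?thesis using True by (simp add: f)
      qed (use f_orth G in blast)
      ultimately show ?thesis ..
    qed
    have \<phi>_c: "ketbra (\<phi> True) + ketbra (\<phi> False) = mat 1"
      by (rule orthonormal_complete) (rule \<phi>)
    have \<kappa>_c: "ketbra (\<kappa> True) + ketbra (\<kappa> False) = mat 1"
      by (rule orthonormal_complete) (rule \<kappa>)
    have EA: "(\<Sum>x\<in>UNIV. \<Sum>a\<in>UNIV. A x a) = mat 1"
      by (simp add: sum_bool A ketbra_tensor_vec e_c \<phi>_c tensor_op_mat_1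
          flip: tensor_op_add_left tensor_op_add_right)
    have EB: "(\<Sum>y\<in>UNIV. \<Sum>b\<in>UNIV. B y b) = mat 1"
      by (simp add: sum_bool B ketbra_tensor_vec f_c \<kappa>_c tensor_op_mat_1
          flip: tensor_op_add_left tensor_op_add_right)
    have total: "(\<Sum>x\<in>UNIV. \<Sum>a\<in>UNIV. \<Sum>y\<in>UNIV. \<Sum>b\<in>UNIV. A x a \<otimes> B y b) = mat 1"
      using tensor_op_mat_1
      by (simp only: tensor_op_sum_left[symmetric] tensor_op_sum_right[symmetric] EA EB)
    \<comment> \<open>A general \<open>h\<close> covers multiplication by \<open>C\<close> from the
      left and from the right. Of the sixteen product projections only the eight allowed ones
      contribute.\<close>
    have supported: "(\<Sum>x\<in>UNIV. \<Sum>a\<in>UNIV. \<Sum>y\<in>UNIV. \<Sum>b\<in>UNIV. h (A x a \<otimes> B y b)) =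
        (\<Sum>s\<in>UNIV. h (ketbra (Q s)))"
      if h: "\<And>x a y b. (a = b) = (x \<and> y) \<Longrightarrow> h (A x a \<otimes> B y b) = 0"
      for h :: "((2 \<times> 2) \<times> (2 \<times> 2)) op \<Rightarrow> ((2 \<times> 2) \<times> (2 \<times> 2)) op"
    proof -
      have "(\<Sum>b\<in>UNIV. h (A x a \<otimes> B y b)) = h (A x a \<otimes> B y (a \<noteq> (x \<and> y)))" for x a y
        using h[of a True x y] h[of a False x y]
        by (cases "a = (x \<and> y)") (auto simp: sum_bool)
      then have "(\<Sum>x\<in>UNIV. \<Sum>a\<in>UNIV. \<Sum>y\<in>UNIV. \<Sum>b\<in>UNIV. h (A x a \<otimes> B y b)) =
          (\<Sum>x\<in>UNIV. \<Sum>a\<in>UNIV. \<Sum>y\<in>UNIV. h (ketbra (Q ((x, y), a))))"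
        by (simp only: Q_def AB prod.case)
      also have "\<dots> = (\<Sum>s\<in>UNIV. h (ketbra (Q s)))"
        unfolding sum_UNIV_prod by (intro sum.cong refl sum.swap)
      finally show ?thesis .
    qed
    have CQ: "(\<Sum>s\<in>UNIV. C ** ketbra (Q s)) = C"
      using arg_cong[OF total, of "\<lambda>X. C ** X"]
      by (subst supported[symmetric]) (auto simp: impossible mult_sum_left)
    have QC: "(\<Sum>s\<in>UNIV. ketbra (Q s) ** C) = C"
      using arg_cong[OF total, of "\<lambda>X. X ** C"]
      by (subst supported[where h = "\<lambda>X. X ** C", symmetric]) (auto simp: impossible mult_sum_right)
    have "C = (\<Sum>s\<in>UNIV. ketbra (Q s) ** (\<Sum>s'\<in>UNIV. C ** ketbra (Q s')))"
      by (simp only: CQ QC)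
    also have "\<dots> = (\<Sum>s\<in>UNIV. \<Sum>s'\<in>UNIV. ketbra (Q s) ** (C ** ketbra (Q s')))"
      by (simp only: mult_sum_left)
    also have "\<dots> = (\<Sum>s\<in>UNIV. \<Sum>s'\<in>UNIV. c $ s $ s' *\<^sub>C outer (Q s) (Q s'))"
      by (simp add: ketbra_eq_outer mult_outer outer_mult_vec c_def)
        (simp add: outer_def scale_op_def mult.assoc)
    finally show "C = (\<Sum>((x, y), a)\<in>UNIV. \<Sum>((x', y'), a')\<in>UNIV. c $ ((x, y), a) $ ((x', y'), a') *\<^sub>C
      outer (tensor_vec (tensor_vec (e x a) (\<phi> x)) (tensor_vec (f y (a \<noteq> (x \<and> y))) (\<kappa> y)))
        (tensor_vec (tensor_vec (e x' a') (\<phi> x')) (tensor_vec (f y' (a' \<noteq> (x' \<and> y'))) (\<kappa> y'))))"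
      by (simp add: Q_def P_def case_prod_unfold)
  qed (fact e f e_perp f_perp \<phi> \<kappa>)+
qed

end

section \<open>The cone of separable operators\<close>

text \<open>Unit vectors make this set compact and give each member trace 1; closedness of the cone
  rests on both.\<close>

definition pure_products :: "('a::finite \<times> 'b::finite) op set"
  where "pure_products = (\<lambda>(v, w). ketbra (tensor_vec v w)) ` (sphere 0 1 \<times> sphere 0 1)"

text \<open>Separable operators without normalisation, so that blocks and limits can be treated
  before a trace is fixed.\<close>

definition sep_cone :: "('a::finite \<times> 'b::finite) op set"
  where "sep_cone = convex_cone hull pure_products"

lemma scaleR_eq_scale_op: "r *\<^sub>R A = of_real r *\<^sub>C A" for A :: "'a::finite op"
  by (simp add: scale_op_def vec_eq_iff scaleR_conv_of_real[where 'a = complex])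

lemma sep_cone_add: "K \<in> sep_cone \<Longrightarrow> L \<in> sep_cone \<Longrightarrow> K + L \<in> sep_cone"
  unfolding sep_cone_def by (rule convex_cone_hull_add)

lemma sep_cone_scale: "K \<in> sep_cone \<Longrightarrow> 0 \<le> r \<Longrightarrow> of_real r *\<^sub>C K \<in> sep_cone"
  unfolding sep_cone_def scaleR_eq_scale_op[symmetric] by (rule convex_cone_hull_mul)

lemma sep_cone_zero: "0 \<in> sep_cone"
  unfolding sep_cone_def by (rule convex_cone_hull_contains_0)

lemma sep_cone_sum: "(\<And>k. k \<in> S \<Longrightarrow> f k \<in> sep_cone) \<Longrightarrow> (\<Sum>k\<in>S. f k) \<in> sep_cone"
  by (induction S rule: infinite_finite_induct) (auto simp: sep_cone_zero sep_cone_add)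

lemma ketbra_normalize:
  assumes "v \<noteq> 0"
  shows "ketbra v = of_real ((norm v)\<^sup>2) *\<^sub>C ketbra (of_real (1 / norm v) *s v)"
  using assms by (simp add: ketbra_def scale_op_def vec_eq_iff power2_eq_square)

lemma norm_vector_scalar_mult: "norm (c *s v) = norm c * norm v" for v :: "complex ^ 'a::finite"
proof -
  have "complex_of_real ((norm (c *s v))\<^sup>2) = of_real ((norm c)\<^sup>2) * of_real ((norm v)\<^sup>2)"
    by (simp only: cinner_self[symmetric] complex_norm_square cinner_scale_left cinner_scale_right
        mult_ac)
  then have "complex_of_real ((norm (c *s v))\<^sup>2) = of_real ((norm c * norm v)\<^sup>2)"
    by (simp only: of_real_mult power_mult_distrib)
  then show ?thesis
    unfolding of_real_eq_iff by (rule power2_eq_imp_eq) simp_all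
qed

lemma sep_cone_ketbra_tensor: "ketbra v \<otimes> ketbra w \<in> sep_cone"
proof (cases "v = 0 \<or> w = 0")
  case True
  then have "ketbra v \<otimes> ketbra w = 0"
    by (auto simp: ketbra_def tensor_op_def vec_eq_iff)
  then show ?thesis by (simp add: sep_cone_zero)
next
  case False
  define v' w' where "v' = of_real (1 / norm v) *s v" and "w' = of_real (1 / norm w) *s w"
  have "norm v' = 1" "norm w' = 1"
    using False by (simp_all add: v'_def w'_def norm_vector_scalar_mult norm_divide)
  then have "ketbra (tensor_vec v' w') \<in> pure_products"
    unfolding pure_products_def by (intro image_eqI[where x = "(v', w')"]) auto
  then have *: "ketbra v' \<otimes> ketbra w' \<in> sep_cone"
    unfolding sep_cone_def by (simp add: ketbra_tensor_vec hull_inc)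
  have "ketbra v \<otimes> ketbra w =
      of_real ((norm v)\<^sup>2 * (norm w)\<^sup>2) *\<^sub>C (ketbra v' \<otimes> ketbra w')"
  proof -
    have "ketbra v = of_real ((norm v)\<^sup>2) *\<^sub>C ketbra v'" "ketbra w = of_real ((norm w)\<^sup>2) *\<^sub>C ketbra w'"
      using False unfolding v'_def w'_def by (blast intro: ketbra_normalize)+
    then show ?thesis
      by (simp only: tensor_op_scale_left tensor_op_scale_right scale_op_scale_op of_real_mult mult.commute)
  qed
  then show ?thesis
    using sep_cone_scale[OF *, of "(norm v)\<^sup>2 * (norm w)\<^sup>2"] by simp
qed

lemma sep_cone_tensor:
  assumes "pos_op A" "pos_op B"
  shows "A \<otimes> B \<in> sep_cone"
proof -
  obtain m n :: nat and v w where "A = (\<Sum>k<m. ketbra (v k))" "B = (\<Sum>k<n. ketbra (w k))"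
    using pos_op_sum_ketbra assms by metis
  then show ?thesis
    by (auto simp: tensor_op_sum_left tensor_op_sum_right intro!: sep_cone_sum sep_cone_ketbra_tensor)
qed

lemma compact_pure_products: "compact (pure_products :: ('a::finite \<times> 'b::finite) op set)"
  unfolding pure_products_def
proof (rule compact_continuous_image)
  show "continuous_on (sphere 0 1 \<times> sphere 0 1)
      (\<lambda>(v :: complex ^ 'a, w :: complex ^ 'b). ketbra (tensor_vec v w))"
    unfolding ketbra_def tensor_vec_def case_prod_unfold
    by (simp, intro continuous_intros)
qed (intro compact_Times compact_sphere)

lemma pure_products_nonempty: "pure_products \<noteq> {}"
proof -
  have "ketbra (tensor_vec (axis undefined 1) (axis undefined 1)) \<in> pure_products"
    unfolding pure_products_def
    by (intro image_eqI[where x = "(axis undefined 1, axis undefined 1)"]) auto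
  then show ?thesis by (rule ex_in_conv[THEN iffD1, OF exI])
qed

lemma trace_convex_hull: "K \<in> convex hull pure_products \<Longrightarrow> trace K = 1"
proof -
  have "convex hull pure_products \<subseteq> {K :: ('a \<times> 'b) op. trace K = 1}"
  proof (rule hull_minimal)
    show "pure_products \<subseteq> {K :: ('a \<times> 'b) op. trace K = 1}"
      by (auto simp: pure_products_def ketbra_tensor_vec trace_tensor_op)
        (simp add: ketbra_eq_outer trace_outer cinner_self)
    show "convex {K :: ('a \<times> 'b) op. trace K = 1}"
      by (auto intro!: convexI simp: trace_add scaleR_eq_scale_op trace_scale_op simp flip: of_real_add)
  qed
  then show "K \<in> convex hull pure_products \<Longrightarrow> trace K = 1" by auto
qed

lemma sep_cone_decomp:
  assumes "K \<in> sep_cone"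
  shows "\<exists>h. h \<in> convex hull pure_products \<and> 0 \<le> Re (trace K) \<and> K = Re (trace K) *\<^sub>R h"
proof -
  obtain h t where h: "h \<in> convex hull pure_products" and t: "0 \<le> t" "K = t *\<^sub>R h"
    using assms unfolding sep_cone_def convex_cone_hull_convex_hull_nonempty[OF pure_products_nonempty]
    by auto
  then have "Re (trace K) = t"
    using trace_convex_hull[OF h] by (simp add: scaleR_eq_scale_op trace_scale_op)
  then show ?thesis using h t by (intro exI[of _ h]) simp
qed

text \<open>The convex hull of the pure products is a compact base on which the trace is 1. The
  scalar of a cone element is thus its trace, which converges along with the sequence, and a
  subsequence of the base points converges by compactness.\<close>

lemma closed_sep_cone: "closed (sep_cone :: ('a::finite \<times> 'b::finite) op set)"
  unfolding closed_sequential_limits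
proof (intro allI impI, elim conjE)
  fix K :: "nat \<Rightarrow> ('a \<times> 'b) op" and L
  assume "\<forall>n. K n \<in> sep_cone" and lim: "K \<longlonglongrightarrow> L"
  then have "\<forall>n. \<exists>h. h \<in> convex hull pure_products \<and> 0 \<le> Re (trace (K n)) \<and> K n = Re (trace (K n)) *\<^sub>R h"
    using sep_cone_decomp by blast
  from choice[OF this] obtain h where
    "\<forall>n. h n \<in> convex hull pure_products \<and> 0 \<le> Re (trace (K n)) \<and> K n = Re (trace (K n)) *\<^sub>R h n" ..
  then have h: "\<forall>n. h n \<in> convex hull pure_products" and t: "\<And>n. 0 \<le> Re (trace (K n))"
    and K: "\<And>n. K n = Re (trace (K n)) *\<^sub>R h n"
    by blast+
  obtain l r where l: "l \<in> convex hull pure_products" and r: "strict_mono (r :: nat \<Rightarrow> nat)"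
    and hl: "(h \<circ> r) \<longlonglongrightarrow> l"
    by (rule seq_compactE[OF compact_imp_seq_compact[OF compact_convex_hull[OF compact_pure_products]] h])
  have T: "(\<lambda>n. Re (trace (K n))) \<longlonglongrightarrow> Re (trace L)"
    unfolding trace_def by (intro tendsto_intros lim)
  have "(\<lambda>n. Re (trace (K (r n))) *\<^sub>R h (r n)) \<longlonglongrightarrow> Re (trace L) *\<^sub>R l"
    using LIMSEQ_subseq_LIMSEQ[OF T r] hl unfolding o_def by (rule tendsto_scaleR)
  then have "(\<lambda>n. K (r n)) \<longlonglongrightarrow> Re (trace L) *\<^sub>R l"
    by (simp only: K[symmetric])
  then have L: "L = Re (trace L) *\<^sub>R l"
    using LIMSEQ_subseq_LIMSEQ[OF lim r] LIMSEQ_unique unfolding o_def by blast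
  have "0 \<le> Re (trace L)"
    using T t by (intro LIMSEQ_le_const) auto
  then show "L \<in> sep_cone"
    using l unfolding sep_cone_def convex_cone_hull_convex_hull_nonempty[OF pure_products_nonempty]
    by (subst L) auto
qed

lemma density_ketbra: "norm v = 1 \<Longrightarrow> density (ketbra v)"
  by (simp add: density_def pos_op_ketbra) (simp add: ketbra_eq_outer trace_outer cinner_self)

text \<open>Unit trace makes the scalar equal to 1, so the operator lies in the convex hull itself.
  A finite convex combination there is a separable decomposition, up to the shift from indices
  \<open>1..k\<close> to indices below \<open>k\<close>.\<close>

lemma separable_if_sep_cone:
  assumes "K \<in> sep_cone" "trace K = 1"
  shows "separable K"
proof -
  have "K \<in> convex hull pure_products"
    using sep_cone_decomp[OF assms(1)] assms(2) by auto
  then obtain k :: nat and u x where ux: "\<And>i. i \<in> {1..k} \<Longrightarrow> 0 \<le> u i \<and> x i \<in> pure_products"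
    and u: "sum u {1..k} = 1" and K: "(\<Sum>i = 1..k. u i *\<^sub>R x i) = K"
    unfolding convex_hull_indexed by blast
  have "\<forall>i\<in>{1..k}. \<exists>v w. norm v = 1 \<and> norm w = 1 \<and> x i = ketbra v \<otimes> ketbra w"
    using ux by (fastforce simp: pure_products_def ketbra_tensor_vec)
  then obtain v w where vw: "\<And>i. i \<in> {1..k} \<Longrightarrow> norm (v i) = 1 \<and> norm (w i) = 1 \<and> x i = ketbra (v i) \<otimes> ketbra (w i)"
    by metis
  have shift: "(\<Sum>i = 1..k. g i) = (\<Sum>i<k. g (Suc i))" for g :: "nat \<Rightarrow> 'z::comm_monoid_add"
    by (simp add: sum.atLeast1_atMost_eq)
  show ?thesis
    unfolding separable_def
  proof (intro exI conjI allI impI)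
    show "0 \<le> u (Suc i)" "density (ketbra (v (Suc i)))" "density (ketbra (w (Suc i)))" if "i < k" for i
      using that ux[of "Suc i"] vw[of "Suc i"] by (auto simp: density_ketbra)
    show "(\<Sum>i<k. u (Suc i)) = 1"
      using u unfolding shift .
    show "K = (\<Sum>i<k. complex_of_real (u (Suc i)) *\<^sub>C (ketbra (v (Suc i)) \<otimes> ketbra (w (Suc i))))"
      unfolding K[symmetric] shift scaleR_eq_scale_op by (intro sum.cong refl) (use vw in auto)
  qed
qed

section \<open>The operator-valued Fejer kernel\<close>

primrec op_power :: "'a::finite op \<Rightarrow> nat \<Rightarrow> 'a op"
  where
    "op_power Y 0 = mat 1"
  | "op_power Y (Suc n) = Y ** op_power Y n"

definition geom_sum :: "'a::finite op \<Rightarrow> complex \<Rightarrow> nat \<Rightarrow> 'a op"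
  where "geom_sum Y z m = (\<Sum>l<m. z ^ l *\<^sub>C op_power Y l)"

lemma geom_sum_0 [simp]: "geom_sum Y z 0 = 0"
  by (simp add: geom_sum_def)

lemma scale_op_add_right: "c *\<^sub>C (A + B) = c *\<^sub>C A + c *\<^sub>C B"
  by (simp add: scale_op_def vec_eq_iff algebra_simps)

lemma scale_op_sum: "c *\<^sub>C (\<Sum>k\<in>S. f k) = (\<Sum>k\<in>S. c *\<^sub>C f k)"
  by (induction S rule: infinite_finite_induct)
    (auto simp: scale_op_add_right, simp_all add: scale_op_def vec_eq_iff)

lemma geom_sum_Suc: "geom_sum Y z (Suc m) = mat 1 + z *\<^sub>C (Y ** geom_sum Y z m)"
  unfolding geom_sum_def sum.lessThan_Suc_shift
  by (simp add: mult_sum_left scale_op_sum scale_op_mult_right scale_op_scale_op)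

text \<open>The Fejer kernel multiplied by \<open>n\<close>.\<close>

definition fejer :: "'a::finite op \<Rightarrow> nat \<Rightarrow> complex \<Rightarrow> 'a op"
  where "fejer Y n z = (let H = (\<Sum>m<n. geom_sum Y z (Suc m)) in
    (\<chi> i j. H $ i $ j + cnj (H $ j $ i) - of_nat n * mat 1 $ i $ j))"

lemma cinner_mult_cnj: "cinner w ((\<chi> i j. cnj (H $ j $ i)) *v w) = cnj (cinner w (H *v w))"
proof -
  have "cinner w ((\<chi> i j. cnj (H $ j $ i)) *v w) =
      (\<Sum>i\<in>UNIV. \<Sum>j\<in>UNIV. cnj (w $ i) * (cnj (H $ j $ i) * w $ j))"
    by (simp add: cinner_def matrix_vector_mult_def sum_distrib_left)
  also have "\<dots> = cnj (cinner w (H *v w))"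
    by (subst sum.swap) (simp add: cinner_def matrix_vector_mult_def sum_distrib_left mult_ac)
  finally show ?thesis .
qed

text \<open>
  With \<open>g m = geom_sum Y z m w\<close>, so that \<open>w = g (m + 1) - z Y (g m)\<close>, each term of the quadratic
  form at \<open>w\<close> is at least \<open>\<parallel>g (m + 1)\<parallel>\<^sup>2 - \<parallel>g m\<parallel>\<^sup>2\<close>.
\<close>

lemma pos_op_fejer:
  assumes contr: "\<And>w. norm (Y *v w) \<le> norm w" and z: "norm z = 1"
  shows "pos_op (fejer Y n z)"
  unfolding pos_op_def
proof
  fix w
  define g where "g = (\<lambda>m. geom_sum Y z m *v w)"
  have g_Suc: "g (Suc m) = w + z *s (Y *v g m)" for m
    by (simp add: g_def geom_sum_Suc matrix_vector_mult_add_rdistrib scale_op_mult_vec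
        matrix_vector_mul_assoc[symmetric])
  define H where "H = (\<Sum>m<n. geom_sum Y z (Suc m))"
  have "fejer Y n z = H + (\<chi> i j. cnj (H $ j $ i)) - of_nat n *\<^sub>C mat 1"
    by (simp add: fejer_def Let_def H_def[symmetric] vec_eq_iff scale_op_def)
  then have "cinner w (fejer Y n z *v w) =
      cinner w (H *v w) + cnj (cinner w (H *v w)) - of_nat n * cinner w w"
    by (simp only: matrix_vector_mult_diff_rdistrib matrix_vector_mult_add_rdistrib cinner_diff_right
        cinner_add_right cinner_mult_cnj scale_op_mult_vec cinner_scale_right matrix_vector_mul_lid)
  also have "cinner w (H *v w) = (\<Sum>m<n. cinner w (g (Suc m)))"
    by (simp add: H_def g_def matrix_sum_rdistrib cinner_sum_right)
  also have "(\<Sum>m<n. cinner w (g (Suc m))) + cnj (\<Sum>m<n. cinner w (g (Suc m))) - of_nat n * cinner w w =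
      of_real (\<Sum>m<n. 2 * Re (cinner w (g (Suc m))) - (norm w)\<^sup>2)"
    by (simp add: complex_add_cnj cinner_self sum_subtractf flip: sum.distrib)
  finally have eq: "cinner w (fejer Y n z *v w) = \<dots>" .
  have "(norm (g (Suc m)))\<^sup>2 - (norm (g m))\<^sup>2 \<le> 2 * Re (cinner w (g (Suc m))) - (norm w)\<^sup>2" for m
  proof -
    have "norm (g (Suc m) - w) \<le> norm (g m)"
      using contr[of "g m"] z by (simp add: g_Suc norm_vector_scalar_mult)
    then have "(norm (g (Suc m) - w))\<^sup>2 \<le> (norm (g m))\<^sup>2"
      by (intro power_mono) auto
    moreover have "complex_of_real ((norm (g (Suc m) - w))\<^sup>2) =
        of_real ((norm (g (Suc m)))\<^sup>2 + (norm w)\<^sup>2 - 2 * Re (cinner w (g (Suc m))))"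
      using complex_add_cnj[of "cinner w (g (Suc m))"] cinner_commute[of "g (Suc m)" w]
      by (simp add: cinner_self[symmetric] cinner_diff_left cinner_diff_right algebra_simps
          del: of_real_power)
    ultimately show ?thesis unfolding of_real_eq_iff by linarith
  qed
  then have "(\<Sum>m<n. (norm (g (Suc m)))\<^sup>2 - (norm (g m))\<^sup>2) \<le>
      (\<Sum>m<n. 2 * Re (cinner w (g (Suc m))) - (norm w)\<^sup>2)"
    by (rule sum_mono)
  moreover have "(\<Sum>m<n. (norm (g (Suc m)))\<^sup>2 - (norm (g m))\<^sup>2) = (norm (g n))\<^sup>2"
    by (subst sum_lessThan_telescope) (simp add: g_def matrix_vector_mult_0)
  ultimately show "0 \<le> cinner w (fejer Y n z *v w)"
    unfolding eq by (simp add: less_eq_complex_def) (meson order_trans zero_le_power2)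
qed

section \<open>Averages over roots of unity\<close>

definition unit_root :: "nat \<Rightarrow> nat \<Rightarrow> complex"
  where "unit_root M k = cis (2 * pi * real k / real M)"

lemma norm_unit_root [simp]: "norm (unit_root M k) = 1"
  by (simp add: unit_root_def)

lemma sum_unit_root_power:
  assumes "0 < l" "l < M"
  shows "(\<Sum>k<M. unit_root M k ^ l) = 0"
proof -
  define q where "q = cis (2 * pi * real l / real M)"
  have "unit_root M k ^ l = q ^ k" for k
    by (simp add: unit_root_def q_def Complex.DeMoivre mult_ac)
  moreover have "q ^ M = 1"
    using assms by (simp add: q_def Complex.DeMoivre cis_multiple_2pi)
  moreover have "q \<noteq> 1"
  proof
    assume "q = 1"
    then obtain m :: int where "2 * pi * real l / real M = 2 * pi * m"
      by (auto simp: q_def cis_conv_exp exp_eq_1 mult_ac)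
    then have "real l = real_of_int m * real M"
      using assms by (simp add: field_simps)
    then have "int l = m * int M" by (metis of_int_eq_iff of_int_mult of_int_of_nat_eq)
    then have "int M dvd int l" by simp
    then show False using assms by (simp add: nat_dvd_not_less)
  qed
  ultimately show ?thesis
    by (simp add: geometric_sum)
qed

lemma cnj_unit_root_mult: "cnj (unit_root M k) * unit_root M k = 1"
  by (metis complex_norm_square mult.commute norm_unit_root of_real_1 one_power2)

lemma sum_unit_root_power_eq:
  assumes "l < M"
  shows "(\<Sum>k<M. unit_root M k ^ l) = (if l = 0 then of_nat M else 0)"
  using sum_unit_root_power[of l M] assms by simp

text \<open>A matrix that links only indices with equal label \<open>q\<close> is block diagonal for
  the grading by \<open>q\<close>, and block diagonal matrices are closed under products.\<close>

lemma op_power_support: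
  assumes "\<And>i j. Y $ i $ j \<noteq> 0 \<Longrightarrow> q i = q j" "op_power Y n $ i $ j \<noteq> 0"
  shows "q i = q j"
  using assms(2)
proof (induction n arbitrary: i)
  case 0
  then show ?case by (auto simp: mat_def split: if_splits)
next
  case (Suc n)
  then obtain k where "Y $ i $ k * op_power Y n $ k $ j \<noteq> 0"
    by (auto simp: matrix_matrix_mult_def elim: sum.not_neutral_contains_not_neutral)
  then show ?case using assms(1) Suc.IH by (metis mult_eq_0_iff)
qed

definition geom_sums :: "'a::finite op \<Rightarrow> nat \<Rightarrow> complex \<Rightarrow> 'a op"
  where "geom_sums Y n z = (\<Sum>m<n. geom_sum Y z (Suc m))"

lemma geom_sums_nth: "geom_sums Y n z $ i $ j = (\<Sum>m<n. \<Sum>l<Suc m. z ^ l * op_power Y l $ i $ j)"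
  by (simp add: geom_sums_def geom_sum_def scale_op_def)

lemma fejer_nth:
  "fejer Y n z $ i $ j = geom_sums Y n z $ i $ j + cnj (geom_sums Y n z $ j $ i) - of_nat n * mat 1 $ i $ j"
  by (simp add: fejer_def geom_sums_def Let_def)

lemma fejer_support:
  assumes "\<And>i j. Y $ i $ j \<noteq> 0 \<Longrightarrow> q i = q j" "fejer Y n z $ i $ j \<noteq> 0"
  shows "q i = q j"
proof (rule ccontr)
  assume "q i \<noteq> q j"
  then have "op_power Y l $ i $ j = 0" "op_power Y l $ j $ i = 0" for l
    using op_power_support[of Y q l, OF assms(1)] by metis+
  then show False
    using assms(2) \<open>q i \<noteq> q j\<close> by (auto simp: fejer_nth geom_sums_nth mat_def split: if_splits)
qed

text \<open>All powers stay below the number of roots, so only constant terms survive: one identity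
  from each of the \<open>n\<close> partial sums.\<close>

lemma sum_geom_sums:
  "(\<Sum>k<Suc n. geom_sums Y n (unit_root (Suc n) k) $ i $ j) = of_nat (Suc n * n) * mat 1 $ i $ j"
proof -
  have "(\<Sum>k<Suc n. geom_sums Y n (unit_root (Suc n) k) $ i $ j) =
      (\<Sum>m<n. \<Sum>l<Suc m. (\<Sum>k<Suc n. unit_root (Suc n) k ^ l) * op_power Y l $ i $ j)"
    unfolding geom_sums_nth sum_distrib_right
    by (subst sum.swap, rule sum.cong[OF refl], subst sum.swap) simp
  also have "\<dots> = (\<Sum>m<n. \<Sum>l<Suc m. if l = 0 then of_nat (Suc n) * mat 1 $ i $ j else 0)"
    by (intro sum.cong refl) (auto simp: sum_unit_root_power_eq simp del: sum.lessThan_Suc)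
  also have "\<dots> = of_nat (Suc n * n) * mat 1 $ i $ j"
    by (simp add: sum.lessThan_Suc_shift ring_distribs del: sum.lessThan_Suc)
  finally show ?thesis .
qed

text \<open>The extra factor shifts the powers to the range from 1 to \<open>n\<close>. With
  \<open>n + 1\<close> roots all of them average to zero; with \<open>n\<close> roots the top power
  would contribute.\<close>

lemma sum_unit_root_geom_sums:
  "(\<Sum>k<Suc n. unit_root (Suc n) k * geom_sums Y n (unit_root (Suc n) k) $ i $ j) = 0"
proof -
  have "(\<Sum>k<Suc n. unit_root (Suc n) k * geom_sums Y n (unit_root (Suc n) k) $ i $ j) =
      (\<Sum>m<n. \<Sum>l<Suc m. (\<Sum>k<Suc n. unit_root (Suc n) k ^ Suc l) * op_power Y l $ i $ j)"
    unfolding geom_sums_nth sum_distrib_right sum_distrib_left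
    by (subst sum.swap, rule sum.cong[OF refl], subst sum.swap) (simp add: mult_ac)
  also have "\<dots> = 0"
    by (intro sum.neutral ballI) (auto simp: sum_unit_root_power_eq simp del: sum.lessThan_Suc power_Suc)
  finally show ?thesis .
qed

text \<open>Only the power \<open>l = 1\<close> survives. It occurs in every partial sum except the
  shortest, whence \<open>n - 1\<close>.\<close>

lemma sum_cnj_unit_root_geom_sums:
  "(\<Sum>k<Suc n. cnj (unit_root (Suc n) k) * geom_sums Y n (unit_root (Suc n) k) $ i $ j) =
    of_nat (Suc n * (n - 1)) * Y $ i $ j"
proof -
  have "(\<Sum>k<Suc n. cnj (unit_root (Suc n) k) * geom_sums Y n (unit_root (Suc n) k) $ i $ j) =
      (\<Sum>m<n. \<Sum>l<Suc m. (\<Sum>k<Suc n. cnj (unit_root (Suc n) k) * unit_root (Suc n) k ^ l) * op_power Y l $ i $ j)"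
    unfolding geom_sums_nth sum_distrib_right sum_distrib_left
    by (subst sum.swap, rule sum.cong[OF refl], subst sum.swap) (simp add: mult_ac)
  also have "\<dots> = (\<Sum>m<n. \<Sum>l<Suc m. if l = 1 then of_nat (Suc n) * Y $ i $ j else 0)"
  proof (intro sum.cong refl)
    fix m l assume "m \<in> {..<n}" "l \<in> {..<Suc m}"
    show "(\<Sum>k<Suc n. cnj (unit_root (Suc n) k) * unit_root (Suc n) k ^ l) * op_power Y l $ i $ j =
      (if l = 1 then of_nat (Suc n) * Y $ i $ j else 0)"
    proof (cases l)
      case 0
      have "(\<Sum>k<Suc n. cnj (unit_root (Suc n) k)) = cnj (\<Sum>k<Suc n. unit_root (Suc n) k ^ 1)"
        by simp
      also have "\<dots> = 0"
        using \<open>m \<in> {..<n}\<close> by (subst sum_unit_root_power_eq) auto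
      finally show ?thesis using 0 by simp
    next
      case (Suc l')
      have "cnj (unit_root (Suc n) k) * unit_root (Suc n) k ^ l = unit_root (Suc n) k ^ l'" for k
        by (simp add: Suc cnj_unit_root_mult flip: mult.assoc)
      then have "(\<Sum>k<Suc n. cnj (unit_root (Suc n) k) * unit_root (Suc n) k ^ l) =
          (\<Sum>k<Suc n. unit_root (Suc n) k ^ l')"
        by (simp only:)
      then show ?thesis
        using \<open>m \<in> {..<n}\<close> \<open>l \<in> {..<Suc m}\<close> Suc
        by (auto simp: sum_unit_root_power_eq simp del: sum.lessThan_Suc)
    qed
  qed
  also have "\<dots> = (\<Sum>m<n. if m = 0 then 0 else of_nat (Suc n) * Y $ i $ j)"
    by (intro sum.cong refl) (simp add: less_Suc_eq_le del: sum.lessThan_Suc)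
  also have "\<dots> = of_nat (Suc n * (n - 1)) * Y $ i $ j"
    by (cases n) (simp_all add: sum.lessThan_Suc_shift ring_distribs del: sum.lessThan_Suc)
  finally show ?thesis .
qed

lemma sum_fejer:
  "(\<Sum>k<Suc n. fejer Y n (unit_root (Suc n) k) $ i $ j) = of_nat (Suc n * n) * mat 1 $ i $ j"
proof -
  have "(\<Sum>k<Suc n. fejer Y n (unit_root (Suc n) k) $ i $ j) =
      (\<Sum>k<Suc n. geom_sums Y n (unit_root (Suc n) k) $ i $ j) +
      cnj (\<Sum>k<Suc n. geom_sums Y n (unit_root (Suc n) k) $ j $ i) - of_nat (Suc n * n) * mat 1 $ i $ j"
    by (simp add: fejer_nth sum.distrib sum_subtractf ring_distribs del: sum.lessThan_Suc)
  then show ?thesis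
    unfolding sum_geom_sums by (simp add: mat_def algebra_simps)
qed

lemma sum_unit_root:
  assumes "0 < n"
  shows "(\<Sum>k<Suc n. unit_root (Suc n) k) = 0"
  using sum_unit_root_power[of 1 "Suc n"] assms by simp

lemma sum_cnj_unit_root_fejer:
  assumes "0 < n"
  shows "(\<Sum>k<Suc n. cnj (unit_root (Suc n) k) * fejer Y n (unit_root (Suc n) k) $ i $ j) =
    of_nat (Suc n * (n - 1)) * Y $ i $ j"
proof -
  have "(\<Sum>k<Suc n. cnj (unit_root (Suc n) k) * fejer Y n (unit_root (Suc n) k) $ i $ j) =
      (\<Sum>k<Suc n. cnj (unit_root (Suc n) k) * geom_sums Y n (unit_root (Suc n) k) $ i $ j) +
      cnj (\<Sum>k<Suc n. unit_root (Suc n) k * geom_sums Y n (unit_root (Suc n) k) $ j $ i) -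
      cnj (\<Sum>k<Suc n. unit_root (Suc n) k) * (of_nat n * mat 1 $ i $ j)"
    by (simp add: fejer_nth sum.distrib sum_subtractf algebra_simps sum_distrib_left sum_distrib_right
        del: sum.lessThan_Suc)
  then show ?thesis
    unfolding sum_unit_root_geom_sums sum_cnj_unit_root_geom_sums sum_unit_root[OF assms] by simp
qed

lemma fejer_cnj: "cnj (fejer Y n z $ i $ j) = fejer Y n z $ j $ i"
  by (simp add: fejer_nth mat_def)

lemma sum_unit_root_fejer:
  assumes "0 < n"
  shows "(\<Sum>k<Suc n. unit_root (Suc n) k * fejer Y n (unit_root (Suc n) k) $ i $ j) =
    of_nat (Suc n * (n - 1)) * cnj (Y $ j $ i)"
  using arg_cong[OF sum_cnj_unit_root_fejer[OF assms, of Y j i], of cnj]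
  by (simp add: fejer_cnj del: sum.lessThan_Suc)

section \<open>Separability of a block with two output branches\<close>

text \<open>The test vector with components \<open>- Y w\<close> and \<open>w\<close> makes the
  upper half of the image zero, and the form takes the value
  \<open>(norm w)\<^sup>2 - (norm (Y *v w))\<^sup>2\<close>.\<close>

lemma pos_block_contraction:
  fixes c :: "('i::finite \<times> bool) op"
  assumes pos: "pos_op c" and diag: "\<And>i i' a. c $ (i, a) $ (i', a) = of_bool (i = i')"
  defines "Y \<equiv> \<chi> i i'. c $ (i, True) $ (i', False)"
  shows "norm (Y *v w) \<le> norm w"
proof -
  define z where "z = Y *v w"
  define v where "v = (\<chi> s. if snd s then - z $ fst s else w $ fst s)"
  have d: "(\<Sum>i'\<in>UNIV. of_bool (i = i') * x i') = x i" for i :: 'i and x :: "'i \<Rightarrow> complex"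
    by (subst sum.cong[OF refl, of _ _ "\<lambda>i'. if i' = i then x i' else 0"]) auto
  have T: "(c *v v) $ (i, True) = 0" for i
    by (simp add: matrix_vector_mult_def[of c] sum_UNIV_prod sum_bool v_def diag sum.distrib sum_subtractf sum_negf d)
      (simp add: z_def Y_def matrix_vector_mult_def)
  have F: "(c *v v) $ (i, False) = w $ i - (\<Sum>i'\<in>UNIV. cnj (Y $ i' $ i) * z $ i')" for i
    using pos_op_cnj[OF pos, of "(i, False)"]
    by (simp add: matrix_vector_mult_def[of c] sum_UNIV_prod sum_bool v_def diag sum.distrib sum_subtractf sum_negf d Y_def)
  have "cinner v (c *v v) = (\<Sum>i\<in>UNIV. cnj (w $ i) * (c *v v) $ (i, False))"
    unfolding cinner_def sum_UNIV_prod sum_bool T by (simp add: v_def)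
  also have "\<dots> = cinner w w - (\<Sum>i\<in>UNIV. \<Sum>i'\<in>UNIV. cnj (Y $ i' $ i * w $ i) * z $ i')"
    by (simp add: F cinner_def right_diff_distrib sum_subtractf sum_distrib_left mult_ac)
  also have "(\<Sum>i\<in>UNIV. \<Sum>i'\<in>UNIV. cnj (Y $ i' $ i * w $ i) * z $ i') = cinner z z"
    unfolding cinner_def by (subst sum.swap) (simp add: z_def matrix_vector_mult_def[of Y w] sum_distrib_right)
  finally have "0 \<le> complex_of_real ((norm w)\<^sup>2 - (norm z)\<^sup>2)"
    using pos_opD[OF pos, of v] by (simp add: cinner_self)
  then have "(norm z)\<^sup>2 \<le> (norm w)\<^sup>2"
    by (simp add: less_eq_complex_def)
  then show ?thesis unfolding z_def by (rule power2_le_imp_le) simp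
qed

text \<open>The form at \<open>x\<close> equals the form of \<open>E\<close> at the vector of inner
  products \<open>cinner (\<xi> i) x\<close>, with the entries outside \<open>P\<close> set to
  zero.\<close>

lemma pos_op_sum_outer:
  fixes E :: "'i::finite op"
  assumes "pos_op E"
  shows "pos_op (\<Sum>i\<in>UNIV. \<Sum>i'\<in>UNIV. (if P i \<and> P i' then E $ i $ i' else 0) *\<^sub>C outer (\<xi> i) (\<xi> i'))"
  unfolding pos_op_def
proof
  fix x
  define y where "y = (\<chi> i. if P i then cinner (\<xi> i) x else 0)"
  have "cinner x ((\<Sum>i\<in>UNIV. \<Sum>i'\<in>UNIV. (if P i \<and> P i' then E $ i $ i' else 0) *\<^sub>C outer (\<xi> i) (\<xi> i')) *v x) =
      (\<Sum>i\<in>UNIV. \<Sum>i'\<in>UNIV. (if P i \<and> P i' then E $ i $ i' else 0) * (cinner (\<xi> i') x * cinner x (\<xi> i)))"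
    by (simp add: matrix_sum_rdistrib cinner_sum_right scale_op_mult_vec outer_mult_vec cinner_scale_right mult.assoc)
  also have "\<dots> = (\<Sum>i\<in>UNIV. \<Sum>i'\<in>UNIV. cnj (y $ i) * (E $ i $ i' * y $ i'))"
    by (intro sum.cong refl) (auto simp: y_def cinner_commute[of x "\<xi> _"])
  also have "\<dots> = cinner y (E *v y)"
    by (simp add: cinner_def matrix_vector_mult_def sum_distrib_left)
  finally show "0 \<le> cinner x ((\<Sum>i\<in>UNIV. \<Sum>i'\<in>UNIV.
      (if P i \<and> P i' then E $ i $ i' else 0) *\<^sub>C outer (\<xi> i) (\<xi> i')) *v x)"
    using pos_opD[OF assms] by simp
qed

lemma scale_op_zero_left [simp]: "0 *\<^sub>C A = 0"
  by (simp add: scale_op_def vec_eq_iff)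

lemma scale_op_add_left: "(c + d) *\<^sub>C A = c *\<^sub>C A + d *\<^sub>C A"
  by (simp add: scale_op_def vec_eq_iff algebra_simps)

text \<open>Indices linked by \<open>E\<close> share their output vector. Grouping by the values of
  \<open>w\<close> therefore leaves, for each value, its projection tensored with a positive
  operator.\<close>

lemma sep_cone_graded:
  fixes E :: "'i::finite op"
  assumes pos: "pos_op E" and supp: "\<And>i i'. E $ i $ i' \<noteq> 0 \<Longrightarrow> w i = w i'"
  shows "(\<Sum>i\<in>UNIV. \<Sum>i'\<in>UNIV. E $ i $ i' *\<^sub>C (outer (w i) (w i') \<otimes> outer (\<xi> i) (\<xi> i'))) \<in> sep_cone"
proof -
  have "E $ i $ i' *\<^sub>C (outer (w i) (w i') \<otimes> outer (\<xi> i) (\<xi> i')) =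
      (\<Sum>W\<in>range w. ketbra W \<otimes> ((if w i = W \<and> w i' = W then E $ i $ i' else 0) *\<^sub>C outer (\<xi> i) (\<xi> i')))"
    for i i'
  proof -
    have "(\<Sum>W\<in>range w. ketbra W \<otimes> ((if w i = W \<and> w i' = W then E $ i $ i' else 0) *\<^sub>C outer (\<xi> i) (\<xi> i'))) =
        (\<Sum>W\<in>range w. if W = w i then (if w i' = w i then E $ i $ i' else 0) *\<^sub>C (ketbra (w i) \<otimes> outer (\<xi> i) (\<xi> i')) else 0)"
      by (rule sum.cong[OF refl]) (auto simp: tensor_op_scale_right)
    also have "\<dots> = (if w i' = w i then E $ i $ i' else 0) *\<^sub>C (ketbra (w i) \<otimes> outer (\<xi> i) (\<xi> i'))"
      by simp
    also have "\<dots> = E $ i $ i' *\<^sub>C (outer (w i) (w i') \<otimes> outer (\<xi> i) (\<xi> i'))"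
      by (cases "E $ i $ i' = 0") (auto simp: ketbra_eq_outer dest: supp)
    finally show ?thesis by simp
  qed
  then have "(\<Sum>i\<in>UNIV. \<Sum>i'\<in>UNIV. E $ i $ i' *\<^sub>C (outer (w i) (w i') \<otimes> outer (\<xi> i) (\<xi> i'))) =
      (\<Sum>i\<in>UNIV. \<Sum>i'\<in>UNIV. \<Sum>W\<in>range w. ketbra W \<otimes> ((if w i = W \<and> w i' = W then E $ i $ i' else 0) *\<^sub>C outer (\<xi> i) (\<xi> i')))"
    by simp
  also have "\<dots> = (\<Sum>W\<in>range w. ketbra W \<otimes> (\<Sum>i\<in>UNIV. \<Sum>i'\<in>UNIV.
      (if w i = W \<and> w i' = W then E $ i $ i' else 0) *\<^sub>C outer (\<xi> i) (\<xi> i')))"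
    unfolding tensor_op_sum_right
    by (rule trans[OF sum.cong[OF refl sum.swap] sum.swap])
  also have "\<dots> \<in> sep_cone"
    by (intro sep_cone_sum sep_cone_tensor pos_op_ketbra pos_op_sum_outer pos)
  finally show ?thesis .
qed

text \<open>In the application \<open>i\<close> is the pair of inputs and the Boolean is Alice's
  outcome. The output vector may depend on both, the input vector on \<open>i\<close> only; so the
  two outputs of one input can be superposed in front of a common input vector.\<close>

definition combine ::
    "('i::finite \<times> bool \<Rightarrow> complex ^ 'm::finite) \<Rightarrow> ('i \<Rightarrow> complex ^ 'n::finite) \<Rightarrow>
     ('i \<times> bool \<Rightarrow> 'i \<times> bool \<Rightarrow> complex) \<Rightarrow> ('m \<times> 'n) op"
  where "combine u \<xi> d =
    (\<Sum>s\<in>UNIV. \<Sum>s'\<in>UNIV. d s s' *\<^sub>C (outer (u s) (u s') \<otimes> outer (\<xi> (fst s)) (\<xi> (fst s'))))"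

lemma combine_add: "combine u \<xi> (\<lambda>s s'. d s s' + d' s s') = combine u \<xi> d + combine u \<xi> d'"
  by (simp add: combine_def scale_op_add_left sum.distrib)

lemma combine_zero: "combine u \<xi> (\<lambda>s s'. 0) = 0"
  by (simp add: combine_def)

lemma combine_sum: "combine u \<xi> (\<lambda>s s'. \<Sum>k\<in>S. d k s s') = (\<Sum>k\<in>S. combine u \<xi> (d k))"
  by (induction S rule: infinite_finite_induct) (auto simp: combine_zero combine_add)

lemma combine_scale: "combine u \<xi> (\<lambda>s s'. r * d s s') = r *\<^sub>C combine u \<xi> d"
  by (simp add: combine_def scale_op_sum scale_op_scale_op)

text \<open>If the coefficients have rank one in the branches, the sum over branches collapses to
  one superposed output vector for each \<open>i\<close>.\<close>

lemma combine_product: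
  defines "w \<equiv> \<lambda>\<zeta> u i. \<zeta> True *s u (i, True) + \<zeta> False *s u (i, False)"
  shows "combine u \<xi> (\<lambda>s s'. E $ fst s $ fst s' * (\<zeta> (snd s) * cnj (\<zeta> (snd s')))) =
    (\<Sum>i\<in>UNIV. \<Sum>i'\<in>UNIV. E $ i $ i' *\<^sub>C (outer (w \<zeta> u i) (w \<zeta> u i') \<otimes> outer (\<xi> i) (\<xi> i')))"
proof -
  have "E $ i $ i' *\<^sub>C (outer (w \<zeta> u i) (w \<zeta> u i') \<otimes> outer (\<xi> i) (\<xi> i')) =
      (\<Sum>a\<in>UNIV. \<Sum>a'\<in>UNIV. (E $ i $ i' * (\<zeta> a * cnj (\<zeta> a'))) *\<^sub>C
        (outer (u (i, a)) (u (i', a')) \<otimes> outer (\<xi> i) (\<xi> i')))" for i i'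
    by (simp add: sum_bool w_def outer_def tensor_op_def scale_op_def vec_eq_iff algebra_simps)
  then have "(\<Sum>i\<in>UNIV. \<Sum>i'\<in>UNIV. E $ i $ i' *\<^sub>C (outer (w \<zeta> u i) (w \<zeta> u i') \<otimes> outer (\<xi> i) (\<xi> i'))) =
      (\<Sum>i\<in>UNIV. \<Sum>i'\<in>UNIV. \<Sum>a\<in>UNIV. \<Sum>a'\<in>UNIV. (E $ i $ i' * (\<zeta> a * cnj (\<zeta> a'))) *\<^sub>C
        (outer (u (i, a)) (u (i', a')) \<otimes> outer (\<xi> i) (\<xi> i')))"
    by simp
  also have "\<dots> = (\<Sum>i\<in>UNIV. \<Sum>a\<in>UNIV. \<Sum>i'\<in>UNIV. \<Sum>a'\<in>UNIV. (E $ i $ i' * (\<zeta> a * cnj (\<zeta> a'))) *\<^sub>C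
        (outer (u (i, a)) (u (i', a')) \<otimes> outer (\<xi> i) (\<xi> i')))"
    by (rule sum.cong[OF refl], rule sum.swap)
  finally show ?thesis
    by (simp add: combine_def sum_UNIV_prod)
qed

lemma tendsto_scale_op: "(f \<longlongrightarrow> c) F \<Longrightarrow> ((\<lambda>x. f x *\<^sub>C A) \<longlongrightarrow> c *\<^sub>C A) F"
  unfolding scale_op_def by (intro tendsto_vec_lambda tendsto_mult tendsto_const)

text \<open>By the support condition the pair of output vectors is constant along the links of
  \<open>Y\<close>, hence along those of its Fejer kernel. So are their superpositions, as
  \<open>sep_cone_graded\<close> demands.\<close>

lemma sep_cone_block:
  fixes c :: "('i::finite \<times> bool) op"
  assumes pos: "pos_op c" and diag: "\<And>i i' a. c $ (i, a) $ (i', a) = of_bool (i = i')"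
    and supp: "\<And>i i'. c $ (i, True) $ (i', False) \<noteq> 0 \<Longrightarrow> u (i, True) = u (i', True) \<and> u (i, False) = u (i', False)"
  shows "combine u \<xi> (\<lambda>s s'. c $ s $ s') \<in> sep_cone"
proof -
  define Y where "Y = (\<chi> i i'. c $ (i, True) $ (i', False))"
  \<comment> \<open>The damping factor \<open>1 - 1/n\<close> is the ratio of the first to the
    zeroth coefficient of the Fejer kernel.\<close>
  define d :: "nat \<Rightarrow> 'i \<times> bool \<Rightarrow> 'i \<times> bool \<Rightarrow> complex" where
    "d = (\<lambda>n s s'. if s = s' then 1 else (1 - 1 / of_nat n) * c $ s $ s')"
  \<comment> \<open>The phase sits on the \<open>False\<close> branch, so the entry from
    \<open>True\<close> to \<open>False\<close> carries the conjugate root and the average selects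
    the coefficient of \<open>Y\<close>.\<close>
  define \<zeta> where "\<zeta> = (\<lambda>n k b. if b then 1 else unit_root (Suc n) k)"
  define F where "F = (\<lambda>n k. fejer Y n (unit_root (Suc n) k))"
  have contr: "norm (Y *v w) \<le> norm w" for w
    unfolding Y_def by (rule pos_block_contraction[OF pos diag])
  have d_eq: "d n s s' = 1 / of_nat (Suc n * n) *
      (\<Sum>k<Suc n. F n k $ fst s $ fst s' * (\<zeta> n k (snd s) * cnj (\<zeta> n k (snd s'))))"
    if n: "0 < n" for n s s'
  proof -
    obtain i a i' a' where s: "s = (i, a)" and s': "s' = (i', a')" by (metis surj_pair)
    have nz: "of_nat (Suc n * n) \<noteq> (0 :: complex)" using n by (simp only: of_nat_eq_0_iff) simp
    have frac: "of_nat (Suc n * (n - 1)) / of_nat (Suc n * n) = (1 - 1 / of_nat n :: complex)"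
    proof -
      have "of_nat (Suc n * (n - 1)) / of_nat (Suc n * n) = (of_nat (n - 1) / of_nat n :: complex)"
        by (simp only: of_nat_mult) (simp del: of_nat_Suc of_nat_diff)
      also have "of_nat (n - 1) = (of_nat n - 1 :: complex)"
        using n by (simp add: of_nat_diff)
      finally show ?thesis using n by (simp add: diff_divide_distrib)
    qed
    consider "a = a'" | "a \<and> \<not> a'" | "\<not> a \<and> a'" by blast
    then show ?thesis
    proof cases
      case 1
      have "F n k $ i $ i' * (\<zeta> n k a * cnj (\<zeta> n k a)) = F n k $ i $ i'" for k
        by (simp add: \<zeta>_def mult.commute[of "unit_root _ _"] cnj_unit_root_mult)
      then have "(\<Sum>k<Suc n. F n k $ fst s $ fst s' * (\<zeta> n k (snd s) * cnj (\<zeta> n k (snd s')))) =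
          of_nat (Suc n * n) * mat 1 $ i $ i'"
        unfolding F_def using 1 by (simp only: s s' fst_conv snd_conv sum_fejer)
      then show ?thesis
        using nz 1 by (simp add: d_def s s' diag mat_def del: of_nat_mult of_nat_Suc)
    next
      case 2
      have "F n k $ i $ i' * (\<zeta> n k a * cnj (\<zeta> n k a')) =
          cnj (unit_root (Suc n) k) * fejer Y n (unit_root (Suc n) k) $ i $ i'" for k
        using 2 by (simp add: \<zeta>_def F_def)
      then have "(\<Sum>k<Suc n. F n k $ fst s $ fst s' * (\<zeta> n k (snd s) * cnj (\<zeta> n k (snd s')))) =
          of_nat (Suc n * (n - 1)) * Y $ i $ i'"
        by (simp only: s s' fst_conv snd_conv sum_cnj_unit_root_fejer[OF n])
      then show ?thesis
        using 2 by (simp add: d_def s s' frac[symmetric] Y_def del: of_nat_mult of_nat_Suc)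
    next
      case 3
      have "F n k $ i $ i' * (\<zeta> n k a * cnj (\<zeta> n k a')) =
          unit_root (Suc n) k * fejer Y n (unit_root (Suc n) k) $ i $ i'" for k
        using 3 by (simp add: \<zeta>_def F_def)
      then have "(\<Sum>k<Suc n. F n k $ fst s $ fst s' * (\<zeta> n k (snd s) * cnj (\<zeta> n k (snd s')))) =
          of_nat (Suc n * (n - 1)) * cnj (Y $ i' $ i)"
        by (simp only: s s' fst_conv snd_conv sum_unit_root_fejer[OF n])
      then show ?thesis
        using 3 pos_op_cnj[OF pos, of "(i, False)" "(i', True)"]
        by (simp add: d_def s s' frac[symmetric] Y_def del: of_nat_mult of_nat_Suc)
    qed
  qed
  have cone: "combine u \<xi> (d n) \<in> sep_cone" if n: "0 < n" for n
  proof -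
    have posF: "pos_op (F n k)" for k
      unfolding F_def by (intro pos_op_fejer contr norm_unit_root)
    have suppF: "u (i, b) = u (i', b)" if "F n k $ i $ i' \<noteq> 0" for i i' b k
    proof -
      have "(u (i, True), u (i, False)) = (u (i', True), u (i', False))"
        using that unfolding F_def
        by (rule fejer_support[where q = "\<lambda>i. (u (i, True), u (i, False))", rotated])
          (use supp in \<open>simp add: Y_def\<close>)
      then show ?thesis by (cases b) auto
    qed
    have "combine u \<xi> (\<lambda>s s'. F n k $ fst s $ fst s' * (\<zeta> n k (snd s) * cnj (\<zeta> n k (snd s')))) \<in> sep_cone" for k
      unfolding combine_product
      by (rule sep_cone_graded[OF posF]) (metis suppF)
    then have "of_real (1 / real (Suc n * n)) *\<^sub>C (\<Sum>k<Suc n.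
        combine u \<xi> (\<lambda>s s'. F n k $ fst s $ fst s' * (\<zeta> n k (snd s) * cnj (\<zeta> n k (snd s'))))) \<in> sep_cone"
      by (intro sep_cone_scale sep_cone_sum) auto
    also have "complex_of_real (1 / real (Suc n * n)) = 1 / of_nat (Suc n * n)"
      by (simp only: of_real_divide of_real_1 of_real_of_nat_eq)
    finally show ?thesis
      unfolding combine_sum[symmetric] combine_scale[symmetric] d_eq[OF n, abs_def] .
  qed
  have "(\<lambda>n. d n s s') \<longlonglongrightarrow> c $ s $ s'" for s s'
  proof (cases "s = s'")
    case True
    then show ?thesis by (cases s') (simp add: d_def diag)
  next
    case False
    have "(\<lambda>n. (1 - 1 / of_nat n) * c $ s $ s') \<longlonglongrightarrow> (1 - 0) * c $ s $ s'"
      by (intro tendsto_intros lim_1_over_n)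
    then show ?thesis using False by (simp add: d_def)
  qed
  then have lim: "(\<lambda>n. combine u \<xi> (d n)) \<longlonglongrightarrow> combine u \<xi> (\<lambda>s s'. c $ s $ s')"
    unfolding combine_def by (intro tendsto_sum tendsto_scale_op)
  have "\<forall>\<^sub>F n in sequentially. combine u \<xi> (d n) \<in> sep_cone"
    by (rule eventually_sequentiallyI[of 1]) (simp add: cone)
  then show ?thesis
    by (rule Lim_in_closed_set[OF closed_sep_cone _ _ lim]) simp
qed

text \<open>
  The two vectors attached to an index are ordered consistently by choosing one of them as a function
  of the unordered pair.
\<close>

lemma sep_cone_oriented:
  fixes c :: "('i::finite \<times> bool) op"
  assumes pos: "pos_op c" and diag: "\<And>s. c $ s $ s = 1"
    and ne: "\<And>i. u (i, True) \<noteq> u (i, False)"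
    and supp: "\<And>i a i' a'. c $ (i, a) $ (i', a') \<noteq> 0 \<Longrightarrow> (i, a) \<noteq> (i', a') \<Longrightarrow>
      u (i', a') = u (i, \<not> a) \<and> u (i, a) = u (i', \<not> a')"
  shows "combine u \<xi> (\<lambda>s s'. c $ s $ s') \<in> sep_cone"
proof -
  \<comment> \<open>The choice is made from the set, so equal unordered pairs receive the same
    \<open>t\<close>. The involution \<open>r\<close> below renames the branches such that
    \<open>True\<close> always carries \<open>t i\<close>.\<close>
  define t where "t = (\<lambda>i. SOME v. v \<in> {u (i, True), u (i, False)})"
  define \<alpha> where "\<alpha> = (\<lambda>i. u (i, True) = t i)"
  define r where "r = (\<lambda>(i, a). (i, a = \<alpha> i))"
  have rr: "r (r s) = s" for s
    by (auto simp: r_def split: prod.splits)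
  then have bij: "bij r"
    by (metis bijI')
  have t: "t i = u (i, True) \<or> t i = u (i, False)" for i
    using someI[of "\<lambda>v. v \<in> {u (i, True), u (i, False)}" "u (i, True)"] by (auto simp: t_def)
  have u_r: "u (r (i, True)) = t i" for i
    using t[of i] by (cases "\<alpha> i") (auto simp: r_def \<alpha>_def)
  have ne_r: "u (r (i, True)) \<noteq> u (r (i, False))" for i
    using ne[of i] by (cases "\<alpha> i") (auto simp: r_def)
  define c' where "c' = (\<chi> s s'. c $ r s $ r s')"
  have r_not: "r (i, \<not> a) = (i, \<not> (a = \<alpha> i))" for i a
    by (auto simp: r_def)
  have supp': "u (r (i', a')) = u (r (i, \<not> a))" "u (r (i, a)) = u (r (i', \<not> a'))"
    if "c' $ (i, a) $ (i', a') \<noteq> 0" "(i, a) \<noteq> (i', a')" for i a i' a'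
  proof -
    have "r (i, a) \<noteq> r (i', a')" using that(2) rr by metis
    then show "u (r (i', a')) = u (r (i, \<not> a))" "u (r (i, a)) = u (r (i', \<not> a'))"
      using supp[of i "a = \<alpha> i" i' "a' = \<alpha> i'"] that(1) by (auto simp: c'_def r_not) (auto simp: r_def)
  qed
  have same: "t i = t i'" if "c' $ (i, a) $ (i', a') \<noteq> 0" for i a i' a'
  proof (cases "(i, a) = (i', a')")
    case False
    have *: "{u (j, True), u (j, False)} = {u (r (j, b)), u (r (j, \<not> b))}" for j b
      unfolding r_not by (cases "b = \<alpha> j") (auto simp: r_def)
    have "{u (i, True), u (i, False)} = {u (i', True), u (i', False)}"
      unfolding *[of i a] *[of i' a'] using supp'[OF that False] by auto
    then show ?thesis unfolding t_def by simp
  qed simp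
  have pos': "pos_op c'"
    unfolding c'_def by (rule pos_op_reindex[OF pos bij])
  have "combine (\<lambda>s. u (r s)) \<xi> (\<lambda>s s'. c' $ s $ s') \<in> sep_cone"
  proof (rule sep_cone_block[OF pos'])
    show "c' $ (i, a) $ (i', a) = of_bool (i = i')" for i i' a
    proof (cases "i = i'")
      case True
      then show ?thesis by (simp add: c'_def diag)
    next
      case False
      \<comment> \<open>A nonzero entry would equate a vector of one index with the vector of the
        other index in the opposite branch. As the orientations agree, the two vectors of
        \<open>i\<close> would coincide.\<close>
      have "c' $ (i, a) $ (i', a) = 0"
      proof (rule ccontr)
        assume nz: "c' $ (i, a) $ (i', a) \<noteq> 0"
        then have "u (r (i', a)) = u (r (i, \<not> a))" "u (r (i, a)) = u (r (i', \<not> a))"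
          using supp' False by auto
        moreover have "u (r (i, True)) = u (r (i', True))"
          using same[OF nz] by (simp add: u_r)
        ultimately show False
          using ne_r[of i] by (cases a) auto
      qed
      then show ?thesis using False by simp
    qed
    show "u (r (i, True)) = u (r (i', True)) \<and> u (r (i, False)) = u (r (i', False))"
      if "c' $ (i, True) $ (i', False) \<noteq> 0" for i i'
      using supp'[OF that] same[OF that] by (auto simp: u_r)
  qed
  also have "combine (\<lambda>s. u (r s)) \<xi> (\<lambda>s s'. c' $ s $ s') = combine u \<xi> (\<lambda>s s'. c $ s $ s')"
  proof -
    have fst_r: "fst (r s) = fst s" for s
      by (simp add: r_def split: prod.splits)
    have "combine (\<lambda>s. u (r s)) \<xi> (\<lambda>s s'. c' $ s $ s') = (\<Sum>s\<in>UNIV. \<Sum>s'\<in>UNIV.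
        c $ r s $ r s' *\<^sub>C (outer (u (r s)) (u (r s')) \<otimes> outer (\<xi> (fst (r s))) (\<xi> (fst (r s')))))"
      by (simp add: combine_def c'_def fst_r)
    also have "\<dots> = combine u \<xi> (\<lambda>s s'. c $ s $ s')"
      unfolding combine_def
      by (simp add: sum.reindex_bij_betw[OF bij, of "\<lambda>s'. c $ _ $ s' *\<^sub>C (outer (u _) (u s') \<otimes> outer (\<xi> (fst _)) (\<xi> (fst s')))"]
          sum.reindex_bij_betw[OF bij, of "\<lambda>s. \<Sum>s'\<in>UNIV. c $ s $ s' *\<^sub>C (outer (u s) (u s') \<otimes> outer (\<xi> (fst s)) (\<xi> (fst s')))"])
    finally show ?thesis .
  qed
  finally show ?thesis .
qed

section \<open>Choi matrices and entanglement breaking\<close>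

text \<open>The Choi correspondence in entries. It is linear in \<open>K\<close>, so membership in
  the cone can be checked on generators.\<close>

definition apply_choi :: "('m::finite \<times> 'n::finite) op \<Rightarrow> ('n \<times> 'r::finite) op \<Rightarrow> ('m \<times> 'r) op"
  where "apply_choi K \<omega> =
    (\<chi> p q. \<Sum>n\<in>UNIV. \<Sum>n'\<in>UNIV. \<omega> $ (n, snd p) $ (n', snd q) * K $ (fst p, n) $ (fst q, n'))"

lemma tensor_id_eq_apply_choi:
  assumes "Vector_Spaces.linear (*\<^sub>C) (*\<^sub>C) \<Phi>"
  shows "tensor_id \<Phi> \<omega> = apply_choi (choi \<Phi>) \<omega>"
proof -
  have hom: "module_hom (*\<^sub>C) (*\<^sub>C) \<Phi>"
    using assms by (simp add: Vector_Spaces.linear_def)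
  define E :: "'a \<Rightarrow> 'a \<Rightarrow> 'a op" where "E = (\<lambda>n n'. \<chi> i j. if i = n \<and> j = n' then 1 else 0)"
  have choi: "choi \<Phi> $ (m, n) $ (m', n') = \<Phi> (E n n') $ m $ m'" for m n m' n'
  proof -
    have "(\<chi> i j. ketbra psi_plus $ (i, n) $ (j, n')) = E n n'"
      by (auto simp: E_def ketbra_def psi_plus_nth vec_eq_iff)
    then show ?thesis by (simp add: choi_def tensor_id_def)
  qed
  have "\<Phi> X $ m $ m' = (\<Sum>n\<in>UNIV. \<Sum>n'\<in>UNIV. X $ n $ n' * choi \<Phi> $ (m, n) $ (m', n'))" for X m m'
  proof -
    have "X = (\<Sum>n\<in>UNIV. \<Sum>n'\<in>UNIV. X $ n $ n' *\<^sub>C E n n')"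
      unfolding vec_eq_iff
    proof (intro allI)
      fix i j
      have "(\<Sum>n\<in>UNIV. \<Sum>n'\<in>UNIV. X $ n $ n' *\<^sub>C E n n') $ i $ j =
          (\<Sum>n\<in>UNIV. \<Sum>n'\<in>UNIV. X $ n $ n' * E n n' $ i $ j)"
        by (simp add: scale_op_def)
      also have "\<dots> = (\<Sum>n\<in>UNIV. \<Sum>n'\<in>UNIV. if n' = j then (if n = i then X $ i $ j else 0) else 0)"
        by (intro sum.cong refl) (auto simp: E_def)
      finally show "X $ i $ j = (\<Sum>n\<in>UNIV. \<Sum>n'\<in>UNIV. X $ n $ n' *\<^sub>C E n n') $ i $ j"
        by simp
    qed
    then have "\<Phi> X = \<Phi> (\<Sum>n\<in>UNIV. \<Sum>n'\<in>UNIV. X $ n $ n' *\<^sub>C E n n')"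
      by (rule arg_cong)
    then have "\<Phi> X = (\<Sum>n\<in>UNIV. \<Sum>n'\<in>UNIV. X $ n $ n' *\<^sub>C \<Phi> (E n n'))"
      by (simp only: module_hom.sum[OF hom] module_hom.scale[OF hom])
    then have "\<Phi> X $ m $ m' = (\<Sum>n\<in>UNIV. \<Sum>n'\<in>UNIV. X $ n $ n' *\<^sub>C \<Phi> (E n n')) $ m $ m'"
      by (rule arg_cong)
    then show ?thesis
      by (simp add: choi scale_op_def)
  qed
  then show ?thesis
    by (simp add: tensor_id_def apply_choi_def)
qed

text \<open>For a pure product the map measures the input and prepares \<open>v\<close>: the result
  is a projection tensored with a positive operator on the reference. Linearity extends this to the
  cone.\<close>

lemma sep_cone_apply_choi:
  fixes K :: "('m::finite \<times> 'n::finite) op" and \<omega> :: "('n \<times> 'r::finite) op"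
  assumes K: "K \<in> sep_cone" and pos: "pos_op \<omega>"
  shows "apply_choi K \<omega> \<in> sep_cone"
proof -
  have "apply_choi (ketbra (tensor_vec v w)) \<omega> \<in> sep_cone" for v :: "complex ^ 'm" and w :: "complex ^ 'n"
  proof -
    define R where "R = (\<chi> r r'. \<Sum>n\<in>UNIV. \<Sum>n'\<in>UNIV. w $ n * cnj (w $ n') * \<omega> $ (n, r) $ (n', r'))"
    have "apply_choi (ketbra (tensor_vec v w)) \<omega> = ketbra v \<otimes> R"
      by (simp add: apply_choi_def R_def ketbra_def tensor_vec_def tensor_op_def vec_eq_iff
          sum_distrib_left mult_ac)
    moreover have "pos_op R"
      unfolding pos_op_def
    proof
      fix x :: "complex ^ 'r"
      \<comment> \<open>The Choi correspondence transposes the input, hence the conjugate of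
        \<open>w\<close>.\<close>
      define y where "y = (\<chi> p. cnj (w $ fst p) * x $ snd p)"
      have "cinner x (R *v x) = (\<Sum>r\<in>UNIV. \<Sum>r'\<in>UNIV. \<Sum>n\<in>UNIV. \<Sum>n'\<in>UNIV.
          cnj (y $ (n, r)) * (\<omega> $ (n, r) $ (n', r') * y $ (n', r')))"
        by (simp add: cinner_def matrix_vector_mult_def R_def y_def sum_distrib_left sum_distrib_right mult_ac)
      also have "\<dots> = (\<Sum>r\<in>UNIV. \<Sum>n\<in>UNIV. \<Sum>r'\<in>UNIV. \<Sum>n'\<in>UNIV.
          cnj (y $ (n, r)) * (\<omega> $ (n, r) $ (n', r') * y $ (n', r')))"
        by (rule sum.cong[OF refl], rule sum.swap)
      also have "\<dots> = (\<Sum>n\<in>UNIV. \<Sum>r\<in>UNIV. \<Sum>n'\<in>UNIV. \<Sum>r'\<in>UNIV.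
          cnj (y $ (n, r)) * (\<omega> $ (n, r) $ (n', r') * y $ (n', r')))"
        by (subst sum.swap) (rule sum.cong[OF refl], rule sum.cong[OF refl], rule sum.swap)
      also have "\<dots> = cinner y (\<omega> *v y)"
        by (simp add: cinner_def matrix_vector_mult_def sum_UNIV_prod sum_distrib_left)
      finally show "0 \<le> cinner x (R *v x)"
        using pos_opD[OF pos] by simp
    qed
    ultimately show ?thesis
      by (simp add: sep_cone_tensor pos_op_ketbra)
  qed
  then have "pure_products \<subseteq> {K :: (('m \<times> 'n) op). apply_choi K \<omega> \<in> sep_cone}"
    by (auto simp: pure_products_def)
  moreover have "convex_cone {K :: (('m \<times> 'n) op). apply_choi K \<omega> \<in> sep_cone}"
  proof -
    have "apply_choi (0 :: ('m \<times> 'n) op) \<omega> = 0"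
      by (simp add: apply_choi_def vec_eq_iff)
    moreover have "apply_choi (K + L) \<omega> = apply_choi K \<omega> + apply_choi L \<omega>" for K L :: "('m \<times> 'n) op"
      by (simp add: apply_choi_def vec_eq_iff sum.distrib algebra_simps)
    moreover have "apply_choi (r *\<^sub>R K) \<omega> = of_real r *\<^sub>C apply_choi K \<omega>" for r and K :: "('m \<times> 'n) op"
      by (simp add: apply_choi_def scaleR_eq_scale_op scale_op_def vec_eq_iff sum_distrib_left mult_ac)
    ultimately show ?thesis
      by (auto simp: convex_cone_iff sep_cone_zero sep_cone_add sep_cone_scale)
  qed
  ultimately have "sep_cone \<subseteq> {K :: (('m \<times> 'n) op). apply_choi K \<omega> \<in> sep_cone}"
    unfolding sep_cone_def[where 'a = 'm and 'b = 'n] by (rule hull_minimal)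
  then show ?thesis using K by auto
qed

lemma trace_tensor_id:
  assumes "\<And>A. trace (\<Phi> A) = trace A"
  shows "trace (tensor_id \<Phi> \<omega>) = trace \<omega>"
proof -
  have "trace (tensor_id \<Phi> \<omega>) = (\<Sum>r\<in>UNIV. trace (\<Phi> (\<chi> i j. \<omega> $ (i, r) $ (j, r))))"
    unfolding trace_def sum_UNIV_prod by (subst sum.swap) (simp add: tensor_id_def)
  also have "\<dots> = trace \<omega>"
    unfolding assms unfolding trace_def sum_UNIV_prod by (subst sum.swap) simp
  finally show ?thesis .
qed

lemma entanglement_breaking_if_choi_sep_cone:
  assumes "channel \<Phi>" "choi \<Phi> \<in> sep_cone"
  shows "entanglement_breaking \<Phi>"
  using assms
  by (auto simp: entanglement_breaking_def channel_def density_def trace_tensor_id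
      tensor_id_eq_apply_choi[symmetric] dest: sep_cone_apply_choi intro!: separable_if_sep_cone)

lemma pos_op_bichoi:
  assumes "channel \<Phi>"
  shows "pos_op (bichoi \<Phi>)"
proof -
  have "bij (\<lambda>((a, i), (b, j)). ((a, b), (i, j)))"
    by (rule bijI') auto
  moreover have "pos_op (choi \<Phi>)"
    unfolding choi_def using assms by (intro pos_op_tensor_id pos_op_ketbra) (simp add: channel_def)
  ultimately show ?thesis
    unfolding bichoi_def Let_def by (intro pos_op_reindex)
qed

lemma choi_nth_eq_bichoi:
  "choi \<Phi> $ p $ q = bichoi \<Phi> $ ((fst (fst p), fst (snd p)), (snd (fst p), snd (snd p))) $
    ((fst (fst q), fst (snd q)), (snd (fst q), snd (snd q)))"
  by (simp add: bichoi_def Let_def)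

text \<open>The expansion is ordered Alice : Bob, but each of its vectors is a product of two output
  and two input vectors. Regrouping these gives \<open>combine\<close> for the cut output :
  input.\<close>

lemma (in pr_box_qubits) choi_sep_cone:
  assumes "bichoi \<Phi> = C"
  shows "choi \<Phi> \<in> sep_cone"
proof (rule choi_expansion)
  fix e f :: "bool \<Rightarrow> bool \<Rightarrow> complex ^ 2" and \<phi> \<kappa> :: "bool \<Rightarrow> complex ^ 2"
    and c :: "((bool \<times> bool) \<times> bool) op"
  assume e: "\<And>x a a'. cinner (e x a) (e x a') = of_bool (a = a')"
    and f: "\<And>y b b'. cinner (f y b) (f y b') = of_bool (b = b')"
    and e_perp: "\<And>x a x' a'. cinner (e x a) (e x' a') = 0 \<Longrightarrow> e x' a' = e x (\<not> a)"
    and f_perp: "\<And>y b y' b'. cinner (f y b) (f y' b') = 0 \<Longrightarrow> f y' b' = f y (\<not> b)"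
    and pos: "pos_op c" and diag: "\<And>s. c $ s $ s = 1 / 2"
    and supp: "\<And>x y a x' y' a'. c $ ((x, y), a) $ ((x', y'), a') \<noteq> 0 \<Longrightarrow> ((x, y), a) \<noteq> ((x', y'), a') \<Longrightarrow>
      cinner (e x a) (e x' a') = 0 \<and> cinner (f y (a \<noteq> (x \<and> y))) (f y' (a' \<noteq> (x' \<and> y'))) = 0"
    and C: "C = (\<Sum>((x, y), a)\<in>UNIV. \<Sum>((x', y'), a')\<in>UNIV. c $ ((x, y), a) $ ((x', y'), a') *\<^sub>C
      outer (tensor_vec (tensor_vec (e x a) (\<phi> x)) (tensor_vec (f y (a \<noteq> (x \<and> y))) (\<kappa> y)))
        (tensor_vec (tensor_vec (e x' a') (\<phi> x')) (tensor_vec (f y' (a' \<noteq> (x' \<and> y'))) (\<kappa> y'))))"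
  define u where "u = (\<lambda>((x, y), a). tensor_vec (e x a) (f y (a \<noteq> (x \<and> y))))"
  define \<xi> where "\<xi> = (\<lambda>(x, y). tensor_vec (\<phi> x) (\<kappa> y))"
  \<comment> \<open>Doubling turns the diagonal entries 1/2 into 1, the normalisation of the
    contraction blocks.\<close>
  have "combine u \<xi> (\<lambda>s s'. (2 *\<^sub>C c) $ s $ s') \<in> sep_cone"
  proof (rule sep_cone_oriented)
    show "pos_op (2 *\<^sub>C c)"
      using pos by (rule pos_op_scale[rotated]) (simp add: less_eq_complex_def)
    show "(2 *\<^sub>C c) $ s $ s = 1" for s
      by (simp add: scale_op_def diag)
    show "u (i, True) \<noteq> u (i, False)" for i
    proof
      obtain x y where i: "i = (x, y)" by fastforce
      assume "u (i, True) = u (i, False)"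
      then have "cinner (u (i, True)) (u (i, True)) = cinner (u (i, True)) (u (i, False))"
        by simp
      then show False by (simp add: u_def i cinner_tensor_vec e f)
    qed
    show "u (i', a') = u (i, \<not> a) \<and> u (i, a) = u (i', \<not> a')"
      if "(2 *\<^sub>C c) $ (i, a) $ (i', a') \<noteq> 0" "(i, a) \<noteq> (i', a')" for i a i' a'
    proof -
      obtain x y where i: "i = (x, y)" by fastforce
      obtain x' y' where i': "i' = (x', y')" by fastforce
      let ?b = "a \<noteq> (x \<and> y)" and ?b' = "a' \<noteq> (x' \<and> y')"
      have "c $ ((x, y), a) $ ((x', y'), a') \<noteq> 0"
        using that(1) by (simp add: scale_op_def i i')
      then have 1: "cinner (e x a) (e x' a') = 0" "cinner (f y ?b) (f y' ?b') = 0"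
        using supp that(2) unfolding i i' by blast+
      then have 2: "cinner (e x' a') (e x a) = 0" "cinner (f y' ?b') (f y ?b) = 0"
        by (subst cinner_commute, simp)+
      \<comment> \<open>Negating Alice's outcome negates the one forced on Bob; so orthogonality on
        both sides leads to the other branch of the same input.\<close>
      have "(\<not> a) \<noteq> (x \<and> y) \<longleftrightarrow> \<not> ?b" "(\<not> a') \<noteq> (x' \<and> y') \<longleftrightarrow> \<not> ?b'"
        by argo+
      then show ?thesis
        unfolding u_def i i' prod.case e_perp[OF 1(1)] f_perp[OF 1(2)]
        using e_perp[OF 1(1)] f_perp[OF 1(2)] e_perp[OF 2(1)] f_perp[OF 2(2)] by simp
    qed
  qed
  also have "combine u \<xi> (\<lambda>s s'. (2 *\<^sub>C c) $ s $ s') = 2 *\<^sub>C combine u \<xi> (\<lambda>s s'. c $ s $ s')"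
    by (simp add: combine_scale[symmetric]) (simp add: scale_op_def)
  finally have "of_real (1 / 2) *\<^sub>C 2 *\<^sub>C combine u \<xi> (\<lambda>s s'. c $ s $ s') \<in> sep_cone"
    by (rule sep_cone_scale) simp
  then have "combine u \<xi> (\<lambda>s s'. c $ s $ s') \<in> sep_cone"
    by (simp add: scale_op_scale_op)
  also have "combine u \<xi> (\<lambda>s s'. c $ s $ s') = choi \<Phi>"
    unfolding vec_eq_iff choi_nth_eq_bichoi assms C
    by (simp add: combine_def u_def \<xi>_def sum_UNIV_prod outer_def tensor_op_def tensor_vec_def
        scale_op_def mult_ac)
  finally show ?thesis .
qed

theorem theorem2:
  fixes \<Phi> :: "(2 \<times> 2) op \<Rightarrow> (2 \<times> 2) op"
  assumes "PR_channel \<Phi>"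
  shows "entanglement_breaking \<Phi>"
proof -
  have ch: "channel \<Phi>" and ns: "non_signaling \<Phi>"
    using assms by (auto simp: PR_channel_def)
  obtain A B :: "bool \<Rightarrow> int \<Rightarrow> (2 \<times> 2) op" where
    A: "\<And>x. ppovm (A x)" and B: "\<And>y. ppovm (B y)"
    and prob: "\<And>x y \<epsilon> \<eta>. \<epsilon> \<in> {1, -1} \<Longrightarrow> \<eta> \<in> {1, -1} \<Longrightarrow> joint_prob \<Phi> (A x) (B y) \<epsilon> \<eta> =
      (if (\<not> (x \<and> y) \<and> \<epsilon> * \<eta> = 1) \<or> ((x \<and> y) \<and> \<epsilon> * \<eta> = -1) then 1 / 2 else 0)"
    using assms unfolding PR_channel_def by blast
  obtain CA CB where CA: "trace_Bout (bichoi \<Phi>) = CA \<otimes> mat 1" and CB: "trace_Aout (bichoi \<Phi>) = mat 1 \<otimes> CB"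
    using ns by (auto simp: non_signaling_def)
  have "\<forall>x. \<exists>\<sigma>. density \<sigma> \<and> A x 1 + A x (-1) = mat 1 \<otimes> \<sigma>" "\<forall>y. \<exists>\<tau>. density \<tau> \<and> B y 1 + B y (-1) = mat 1 \<otimes> \<tau>"
    using A B by (auto simp: ppovm_def)
  then obtain \<sigma> \<tau> where \<sigma>: "\<And>x. density (\<sigma> x)" "\<And>x. A x 1 + A x (-1) = mat 1 \<otimes> \<sigma> x"
    and \<tau>: "\<And>y. density (\<tau> y)" "\<And>y. B y 1 + B y (-1) = mat 1 \<otimes> \<tau> y"
    by metis
  \<comment> \<open>This encoding turns equality of Boolean outcomes into product 1 of
    signs.\<close>
  define sg :: "bool \<Rightarrow> int" where "sg = (\<lambda>a. if a then 1 else -1)"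
  interpret pr_box_qubits "bichoi \<Phi>" CA CB "\<lambda>x a. A x (sg a)" "\<lambda>y b. B y (sg b)" \<sigma> \<tau>
  proof
    show "trace ((A x (sg a) \<otimes> B y (sg b)) ** bichoi \<Phi>) = (if (a = b) = (\<not> (x \<and> y)) then 1 / 2 else 0)"
      for x a y b
      using prob[of "sg a" "sg b" x y] by (cases a; cases b) (auto simp: joint_prob_def sg_def)
  qed (use A B in \<open>auto simp: pos_op_bichoi[OF ch] CA CB \<sigma> \<tau> sg_def ppovm_def\<close>)
  show ?thesis
    by (rule entanglement_breaking_if_choi_sep_cone[OF ch choi_sep_cone[OF refl]])
qed

end
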